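(* For any $l\in\mathbb{Z}$ and any ideal $I\unlhd\mathbb{C}[K^{\pm1},C_1]$, the set of all Whittaker vectors of type $(\alpha q^l, 0)$ in the Whittaker module $V(\eta, I)=M(\eta)/W(\eta,I)$ is $$\operatorname{span}\{K_2^l\mathbb{C}[K^{\pm1}, C_1]\bar v_\eta\}\cup \{\bar u(n,l,Q)\ |\ n\in\mathbb{N}, Q\in \hat I_n\setminus I\},$$ where $\bar v_\eta, \bar u(n,l,Q)\in V(\eta, I)$ are the images of $v_\eta$ and $u(n,l,Q)$. In particular, the set of Whittaker vectors of type $(\alpha q^l, 0)$ in $M(\eta)$ is $K_2^l\mathbb{C}[K^{\pm1}, C_1]v_\eta$.
   Context: Let $q\in\mathbb{C}$ be nonzero and not a root of unity, and $U=U_q(\mathfrak{sl}_3)$ the algebra generated by $E_1,E_2,F_1,F_2,K_1^{\pm1},K_2^{\pm1}$ with the Jimbo relations ($[E_i,F_j]=\delta_{ij}\frac{K_i-K_i^{-1}}{q-q^{-1}}$, $K_i^{\pm1}E_j=q^{\pm a_{ij}}E_jK_i^{\pm1}$, $K_i^{\pm1}F_j=q^{\mp a_{ij}}F_jK_i^{\pm1}$ with $a_{11}=a_{22}=2$, $a_{12}=a_{21}=-1$, and the quantum Serre relations). Put $F_3=F_1F_2-qF_2F_1$, $K=K_1K_2^2$, $C_1=F_1E_1+\frac{qK_1+q^{-1}K_1^{-1}}{(q-q^{-1})^2}$. Let $U^+$ be the subalgebra generated by $E_1,E_2$, and $\eta:U^+\to\mathbb{C}$ the algebra homomorphism with $\eta(E_1)=\alpha\neq0$,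 $\eta(E_2)=0$. $M(\eta)=U\otimes_{U^+}\mathbb{C}v_\eta$, where $xv_\eta=\eta(x)v_\eta$ for $x\in U^+$. A vector $w$ is a Whittaker vector of type $(\beta,0)$ if $E_1w=\beta w$ and $E_2w=0$. For an ideal $I\unlhd\mathbb{C}[K^{\pm1},C_1]$, $W(\eta,I)=UIv_\eta$ and $V(\eta,I)=M(\eta)/W(\eta,I)$. Write $[k]=\frac{q^k-q^{-k}}{q-q^{-1}}$, $[k]!=[k][k-1]\cdots[1]$, $[0]!=1$, and let $\genfrac{[}{]}{0pt}{}{n}{k}=\frac{[n]!}{[k]![n-k]!}$ for $0\le k\le n$ (and $0$ otherwise) be the $q$-binomial coefficient. For $n\in\mathbb{Z}_+$, $l\in\mathbb{Z}$, $Q\in\mathbb{C}[K^{\pm1},C_1]$, define $$u(n,l,Q)=q^{2nl}K_2^l\sum_{k=0}^{n}\sum_{j=0}^{n-k}a_{kj}(n)F_2^{n-k}F_3^kK_2^{2j}K^{-2j-k}Qv_\eta,$$ $a_{kj}(n)=(-1)^j\alpha^k(q^2-1)^kq^{j(n-3)}q^{\frac{1}{2}k(2n+2j+k-7)}\genfrac{[}{]}{0pt}{}{n}{k}\genfrac{[}{]}{0pt}{}{n-k}{j}$. For $n\in\mathbb{N}$ (positive integers), $h_n(K,C_1)=q^{3-2n}K+q^{2n-3}K^{-1}-(q-q^{-1})^2C_1$ and $\hat I_n=\{Q\in\mathbb{C}[K^{\pm1},C_1]\mid h_n(K,C_1)Q\in I\}$. *)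

theory Defs
  imports Complex_Main "HOL-Library.Poly_Mapping" "HOL-Library.Product_Plus"
begin

datatype gen = E1 | E2 | F1 | F2 | K1 | K1i | K2 | K2i

text \<open>Noncommutative polynomials: coefficient functions on words.
  Elements of the free algebra are the finitely supported ones.\<close>
type_synonym fa = "gen list \<Rightarrow> complex"

definition FA :: "fa set" where
  "FA = {f. finite {w. f w \<noteq> 0}}"

definition fa_zero :: fa where "fa_zero = (\<lambda>w. 0)"
definition fa_add :: "fa \<Rightarrow> fa \<Rightarrow> fa" where "fa_add f g = (\<lambda>w. f w + g w)"
definition fa_diff :: "fa \<Rightarrow> fa \<Rightarrow> fa" where "fa_diff f g = (\<lambda>w. f w - g w)"
definition fa_smul :: "complex \<Rightarrow> fa \<Rightarrow> fa" where "fa_smul c f = (\<lambda>w. c * f w)"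
definition fa_mul :: "fa \<Rightarrow> fa \<Rightarrow> fa" where
  "fa_mul f g = (\<lambda>w. \<Sum>i\<le>length w. f (take i w) * g (drop i w))"
definition fa_mon :: "gen list \<Rightarrow> fa" where
  "fa_mon u = (\<lambda>w. if w = u then 1 else 0)"
definition fa_lc :: "(complex \<times> gen list) list \<Rightarrow> fa" where
  "fa_lc xs = (\<lambda>w. \<Sum>(c, u)\<leftarrow>xs. if w = u then c else 0)"
definition fa_sum :: "('a \<Rightarrow> fa) \<Rightarrow> 'a set \<Rightarrow> fa" where
  "fa_sum f A = (\<lambda>w. \<Sum>a\<in>A. f a w)"

primrec fa_pow :: "fa \<Rightarrow> nat \<Rightarrow> fa" where
  "fa_pow f 0 = fa_mon []"
| "fa_pow f (Suc n) = fa_mul f (fa_pow f n)"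

definition Eg :: "nat \<Rightarrow> gen" where "Eg i = (if i = 1 then E1 else E2)"
definition Fg :: "nat \<Rightarrow> gen" where "Fg i = (if i = 1 then F1 else F2)"
definition Kg :: "nat \<Rightarrow> gen" where "Kg i = (if i = 1 then K1 else K2)"
definition Kig :: "nat \<Rightarrow> gen" where "Kig i = (if i = 1 then K1i else K2i)"
definition cartan :: "nat \<Rightarrow> nat \<Rightarrow> int" where "cartan i j = (if i = j then 2 else -1)"

definition uq_rels :: "complex \<Rightarrow> fa set" where
  "uq_rels q =
     {fa_lc [(1, [Kg i, Kig i]), (-1, [])] | i. i \<in> {1,2}}
   \<union> {fa_lc [(1, [Kig i, Kg i]), (-1, [])] | i. i \<in> {1,2}}
   \<union> {fa_lc [(1, [K1, K2]), (-1, [K2, K1])]}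
   \<union> {fa_lc [(1, [Eg i, Fg j]), (-1, [Fg j, Eg i]),
              (- (if i = j then 1 else 0) / (q - inverse q), [Kg i]),
              ((if i = j then 1 else 0) / (q - inverse q), [Kig i])]
       | i j. i \<in> {1,2} \<and> j \<in> {1,2}}
   \<union> {fa_lc [(1, [Kg i, Eg j]), (- (q powi cartan i j), [Eg j, Kg i])] | i j. i \<in> {1,2} \<and> j \<in> {1,2}}
   \<union> {fa_lc [(1, [Kig i, Eg j]), (- (q powi (- cartan i j)), [Eg j, Kig i])] | i j. i \<in> {1,2} \<and> j \<in> {1,2}}
   \<union> {fa_lc [(1, [Kg i, Fg j]), (- (q powi (- cartan i j)), [Fg j, Kg i])] | i j. i \<in> {1,2} \<and> j \<in> {1,2}}
   \<union> {fa_lc [(1, [Kig i, Fg j]), (- (q powi cartan i j), [Fg j, Kig i])] | i j. i \<in> {1,2} \<and> j \<in> {1,2}}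
   \<union> {fa_lc [(1, [Eg i, Eg i, Eg j]), (- (q + inverse q), [Eg i, Eg j, Eg i]), (1, [Eg j, Eg i, Eg i])]
       | i j. (i, j) \<in> {(1,2), (2,1)}}
   \<union> {fa_lc [(1, [Fg i, Fg i, Fg j]), (- (q + inverse q), [Fg i, Fg j, Fg i]), (1, [Fg j, Fg i, Fg i])]
       | i j. (i, j) \<in> {(1,2), (2,1)}}"

text \<open>The two-sided ideal of the free algebra generated by the relations;
  U_q(sl_3) is the free algebra modulo this ideal.\<close>
inductive_set uq_ideal :: "complex \<Rightarrow> fa set" for q where
  rel: "r \<in> uq_rels q \<Longrightarrow> r \<in> uq_ideal q"
| zero: "fa_zero \<in> uq_ideal q"
| add: "a \<in> uq_ideal q \<Longrightarrow> b \<in> uq_ideal q \<Longrightarrow> fa_add a b \<in> uq_ideal q"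
| smul: "a \<in> uq_ideal q \<Longrightarrow> fa_smul c a \<in> uq_ideal q"
| lmul: "a \<in> uq_ideal q \<Longrightarrow> fa_mul (fa_mon [x]) a \<in> uq_ideal q"
| rmul: "a \<in> uq_ideal q \<Longrightarrow> fa_mul a (fa_mon [x]) \<in> uq_ideal q"

text \<open>Laurent polynomials in K and polynomials in C_1: the monomial K^i C_1^j
  has key (i, j).\<close>
type_synonym lp = "(int \<times> nat) \<Rightarrow>\<^sub>0 complex"

definition is_ideal :: "lp set \<Rightarrow> bool" where
  "is_ideal I \<longleftrightarrow> 0 \<in> I \<and> (\<forall>a\<in>I. \<forall>b\<in>I. a + b \<in> I) \<and> (\<forall>r a. a \<in> I \<longrightarrow> r * a \<in> I)"

definition K_el :: fa where "K_el = fa_mon [K1, K2, K2]"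
definition Kinv_el :: fa where "Kinv_el = fa_mon [K1i, K2i, K2i]"

definition Kpow :: "int \<Rightarrow> fa" where
  "Kpow i = (if 0 \<le> i then fa_pow K_el (nat i) else fa_pow Kinv_el (nat (- i)))"
definition K2pow :: "int \<Rightarrow> fa" where
  "K2pow i = (if 0 \<le> i then fa_pow (fa_mon [K2]) (nat i) else fa_pow (fa_mon [K2i]) (nat (- i)))"

definition C1_el :: "complex \<Rightarrow> fa" where
  "C1_el q = fa_lc [(1, [F1, E1]), (q / (q - inverse q)^2, [K1]), (inverse q / (q - inverse q)^2, [K1i])]"

definition lp_ev :: "complex \<Rightarrow> lp \<Rightarrow> fa" where
  "lp_ev q p = fa_sum (\<lambda>(i, j). fa_smul (Poly_Mapping.lookup p (i, j)) (fa_mul (Kpow i) (fa_pow (C1_el q) j))) (Poly_Mapping.keys p)"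

definition h_poly :: "complex \<Rightarrow> nat \<Rightarrow> lp" where
  "h_poly q n = Poly_Mapping.single (1, 0) (q powi (3 - 2 * int n))
              + Poly_Mapping.single (-1, 0) (q powi (2 * int n - 3))
              - Poly_Mapping.single (0, 1) ((q - inverse q)^2)"

definition I_hat :: "complex \<Rightarrow> lp set \<Rightarrow> nat \<Rightarrow> lp set" where
  "I_hat q I n = {Q. h_poly q n * Q \<in> I}"

text \<open>Preimage in the free algebra of W(eta, I) (together with the defining ideal of U
  and the annihilator of v_eta): the left ideal generated by the relations of U,
  E_1 - alpha, E_2 and the elements of I.  M(eta) = U (x)_{U^+} C v_eta is the
  free algebra modulo the case I = {}; V(eta, I) is the free algebra modulo this.
  The element v_eta (resp. its image) is represented by the unit word [].\<close>
inductive_set whit_sub :: "complex \<Rightarrow> complex \<Rightarrow> lp set \<Rightarrow> fa set" for q \<alpha> I where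
  ideal: "a \<in> uq_ideal q \<Longrightarrow> a \<in> whit_sub q \<alpha> I"
| e1: "fa_diff (fa_mon [E1]) (fa_smul \<alpha> (fa_mon [])) \<in> whit_sub q \<alpha> I"
| e2: "fa_mon [E2] \<in> whit_sub q \<alpha> I"
| idl: "Q \<in> I \<Longrightarrow> lp_ev q Q \<in> whit_sub q \<alpha> I"
| zero: "fa_zero \<in> whit_sub q \<alpha> I"
| add: "a \<in> whit_sub q \<alpha> I \<Longrightarrow> b \<in> whit_sub q \<alpha> I \<Longrightarrow> fa_add a b \<in> whit_sub q \<alpha> I"
| smul: "a \<in> whit_sub q \<alpha> I \<Longrightarrow> fa_smul c a \<in> whit_sub q \<alpha> I"
| lmul: "a \<in> whit_sub q \<alpha> I \<Longrightarrow> fa_mul (fa_mon [x]) a \<in> whit_sub q \<alpha> I"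

text \<open>The class of w in FA / N is a Whittaker vector of type (beta, 0).\<close>
definition is_whittaker :: "fa set \<Rightarrow> complex \<Rightarrow> fa \<Rightarrow> bool" where
  "is_whittaker N \<beta> w \<longleftrightarrow>
     fa_diff (fa_mul (fa_mon [E1]) w) (fa_smul \<beta> w) \<in> N \<and> fa_mul (fa_mon [E2]) w \<in> N"

inductive_set fa_span :: "fa set \<Rightarrow> fa set" for S where
  zero: "fa_zero \<in> fa_span S"
| base: "s \<in> S \<Longrightarrow> s \<in> fa_span S"
| add: "a \<in> fa_span S \<Longrightarrow> b \<in> fa_span S \<Longrightarrow> fa_add a b \<in> fa_span S"
| smul: "a \<in> fa_span S \<Longrightarrow> fa_smul c a \<in> fa_span S"

definition qint :: "complex \<Rightarrow> nat \<Rightarrow> complex" where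
  "qint q k = (q ^ k - inverse q ^ k) / (q - inverse q)"
definition qfact :: "complex \<Rightarrow> nat \<Rightarrow> complex" where
  "qfact q n = (\<Prod>i\<in>{1..n}. qint q i)"
definition qbinom :: "complex \<Rightarrow> nat \<Rightarrow> nat \<Rightarrow> complex" where
  "qbinom q n k = (if k \<le> n then qfact q n / (qfact q k * qfact q (n - k)) else 0)"

text \<open>k(2n+2j+k-7) is always even, so the exponent below is an integer.\<close>
definition a_coef :: "complex \<Rightarrow> complex \<Rightarrow> nat \<Rightarrow> nat \<Rightarrow> nat \<Rightarrow> complex" where
  "a_coef q \<alpha> n k j =
     (-1) ^ j * \<alpha> ^ k * (q^2 - 1) ^ k * q powi (int j * (int n - 3))
     * q powi ((int k * (2 * int n + 2 * int j + int k - 7)) div 2)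
     * qbinom q n k * qbinom q (n - k) j"

definition F3_el :: "complex \<Rightarrow> fa" where
  "F3_el q = fa_lc [(1, [F1, F2]), (- q, [F2, F1])]"

definition u_vec :: "complex \<Rightarrow> complex \<Rightarrow> nat \<Rightarrow> int \<Rightarrow> lp \<Rightarrow> fa" where
  "u_vec q \<alpha> n l Q =
     fa_smul (q powi (2 * int n * l))
       (fa_mul (K2pow l)
         (fa_sum (\<lambda>(k, j). fa_smul (a_coef q \<alpha> n k j)
              (fa_mul (fa_pow (fa_mon [F2]) (n - k))
              (fa_mul (fa_pow (F3_el q) k)
              (fa_mul (K2pow (2 * int j))
              (fa_mul (Kpow (- 2 * int j - int k))
                      (lp_ev q Q))))))
            {(k, j). k \<le> n \<and> j \<le> n - k}))"

end

theory Submission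
  imports Defs
begin

text \<open>
  In the basis \<open>F\<^sub>2\<^sup>a F\<^sub>3\<^sup>b K\<^sub>2\<^sup>j v\<close> over the Laurent polynomials in \<open>K\<close>, \<open>C\<^sub>1\<close>, the generators of
  \<open>U\<close> act on \<open>M(\<eta>)\<close> by explicit shift operators; taking these formulas as a definition gives a module, and
  normal ordering shows that it is all of \<open>M(\<eta>)\<close>. Hence \<open>W(\<eta>, I)\<close> consists of the elements whose
  coefficients all lie in \<open>I\<close>, and a Whittaker vector is a solution of two recurrences modulo \<open>I\<close>, both
  homogeneous in the degree \<open>n = a + b\<close>. In degree \<open>n\<close> a solution is determined by its coefficient \<open>Q\<close> at
  \<open>F\<^sub>2\<^sup>n K\<^sub>2\<^sup>l\<close>, so it is \<open>u(n, l, Q)\<close>, and the equations that remain say \<open>h\<^sub>n Q \<in> I\<close>. For \<open>I = 0\<close> this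
  forces \<open>Q = 0\<close> when \<open>n > 0\<close>, because \<open>h\<^sub>n\<close> has an invertible leading coefficient in \<open>C\<^sub>1\<close>.
\<close>

text \<open>\<open>uq_ideal\<close> and \<open>whit_sub\<close> are given by generators, so
  manipulating generators only ever shows that something lies in them. The concrete module supplies
  the missing half, linear independence; normal ordering has to supply only spanning. F_1 is absent
  from the basis because \<alpha> \<noteq> 0: from E_1 v = \<alpha> v the definition of C_1 becomes
  \<alpha> F_1 v = (C_1 - torus terms) v, so F_1 is traded for C_1. K and C_1 can serve as scalars
  because K v and C_1 v are again Whittaker vectors of type (\<alpha>, 0): K commutes with E_1, C_1
  is the Casimir element of the sl_2 generated by E_1 and F_1, and E_2 kills both vectors.
  Multiplying coefficients is therefore an endomorphism of the module. The action formulas record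
  how a generator moves past F_2^a F_3^b K_2^j, using F_1 F_2 = q F_2 F_1 + F_3, E_1 F_3 = F_3 E_1 +
  F_2 K_1^(-1) and E_2 F_3 = F_3 E_2 - q F_1 K_2. That q is not a root of unity enters through [m]
  \<noteq> 0 for m \<noteq> 0 and through the injectivity of integer powers of q.\<close>

instantiation list :: (type) monoid_add
begin
definition zero_list :: "'a list" where "zero_list = []"
definition plus_list :: "'a list \<Rightarrow> 'a list \<Rightarrow> 'a list" where "plus_list = (@)"
instance by standard (simp_all add: zero_list_def plus_list_def)
end

section \<open>Linear extensions to finitely supported functions\<close>

text \<open>The summand receives key and coefficient together, because in \<open>nf\<close> the
  coefficient P enters as \<open>evA P\<close> and not as a scalar factor.\<close>

definition pm_lift :: "('k \<Rightarrow> 'a::zero \<Rightarrow> 'b::comm_monoid_add) \<Rightarrow> ('k \<Rightarrow>\<^sub>0 'a) \<Rightarrow> 'b" where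
  "pm_lift h x = (\<Sum>k\<in>Poly_Mapping.keys x. h k (Poly_Mapping.lookup x k))"

lemma pm_lift_superset:
  assumes "\<And>k. h k 0 = 0" "finite S" "Poly_Mapping.keys x \<subseteq> S"
  shows "pm_lift h x = (\<Sum>k\<in>S. h k (Poly_Mapping.lookup x k))"
  unfolding pm_lift_def
  by (rule sum.mono_neutral_left) (use assms in \<open>auto simp: in_keys_iff\<close>)

lemma pm_lift_0 [simp]: "pm_lift h 0 = 0"
  by (simp add: pm_lift_def)

lemma pm_lift_add:
  fixes x y :: "'k \<Rightarrow>\<^sub>0 'a::comm_monoid_add"
  assumes "\<And>k. h k 0 = 0" "\<And>k a b. h k (a + b) = h k a + h k b"
  shows "pm_lift h (x + y) = pm_lift h x + pm_lift h y"
proof -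
  let ?S = "Poly_Mapping.keys x \<union> Poly_Mapping.keys y"
  have "pm_lift h (x + y) = (\<Sum>k\<in>?S. h k (Poly_Mapping.lookup (x + y) k))"
    by (rule pm_lift_superset) (use assms Poly_Mapping.keys_add[of x y] in auto)
  also have "\<dots> = (\<Sum>k\<in>?S. h k (Poly_Mapping.lookup x k)) + (\<Sum>k\<in>?S. h k (Poly_Mapping.lookup y k))"
    by (simp add: lookup_add assms sum.distrib)
  also have "\<dots> = pm_lift h x + pm_lift h y"
    by (subst (1 2) pm_lift_superset[where S = ?S]) (use assms in auto)
  finally show ?thesis .
qed

lemma pm_lift_single [simp]:
  assumes "\<And>k. h k 0 = 0"
  shows "pm_lift h (Poly_Mapping.single k c) = h k c"
  by (subst pm_lift_superset[where S = "{k}"]) (use assms in auto)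

lemma poly_mapping_add_induct [case_names zero single add]:
  fixes x :: "'k \<Rightarrow>\<^sub>0 'a::comm_monoid_add"
  assumes "P 0" "\<And>k c. P (Poly_Mapping.single k c)" "\<And>x y. P x \<Longrightarrow> P y \<Longrightarrow> P (x + y)"
  shows "P x"
proof -
  have *: "x = (\<Sum>k\<in>Poly_Mapping.keys x. Poly_Mapping.single k (Poly_Mapping.lookup x k))"
    by (rule poly_mapping_eqI)
       (auto simp: lookup_sum lookup_single when_def in_keys_iff)
  have "P (\<Sum>k\<in>S. Poly_Mapping.single k (Poly_Mapping.lookup x k))" if "finite S" for S
    using that by induction (auto intro: assms)
  then show ?thesis by (subst *) simp
qed

section \<open>The free algebra as a ring\<close>

text \<open>The library product of finitely supported functions is convolution over an additive
  monoid of keys. With lists as a monoid under concatenation it is the product of the free algebra,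
  so ring reasoning becomes available.\<close>

type_synonym free_alg = "gen list \<Rightarrow>\<^sub>0 complex"

abbreviation gn :: "gen \<Rightarrow> free_alg" where "gn x \<equiv> Poly_Mapping.single [x] 1"
abbreviation sA :: "complex \<Rightarrow> free_alg" where "sA c \<equiv> Poly_Mapping.single [] c"
abbreviation fa_of :: "free_alg \<Rightarrow> fa" where "fa_of \<equiv> Poly_Mapping.lookup"

lemma single_Nil_1 [simp]: "sA 1 = 1"
  by (metis single_one zero_list_def)

lemma mult_single_list: "Poly_Mapping.single u c * Poly_Mapping.single v d = Poly_Mapping.single (u @ v) (c * d)"
  for u v :: "'b list" and c d :: complex
  by (simp add: mult_single plus_list_def)

lemma sA_mult: "sA c * sA d = sA (c * d)"
  by (simp add: mult_single_list)

lemma sA_central: "x * sA c = sA c * x"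
proof (induction x rule: poly_mapping_add_induct)
  case (single k d)
  then show ?case by (simp add: mult_single_list mult.commute)
qed (simp_all add: algebra_simps)

lemma sA_left_commute: "x * (sA c * y) = sA c * (x * y)"
  by (metis mult.assoc sA_central)

lemma lookup_sA_mult: "fa_of (sA c * x) w = c * fa_of x w"
proof (induction x rule: poly_mapping_add_induct)
  case (single k d)
  then show ?case by (simp add: mult_single_list lookup_single when_def)
qed (simp_all add: algebra_simps lookup_add)

lemma fa_of_zero: "fa_zero = fa_of 0"
  by (simp add: fa_zero_def fun_eq_iff)
lemma fa_of_add: "fa_add (fa_of x) (fa_of y) = fa_of (x + y)"
  by (simp add: fa_add_def fun_eq_iff lookup_add)
lemma fa_of_diff: "fa_diff (fa_of x) (fa_of y) = fa_of (x - y)"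
  by (simp add: fa_diff_def fun_eq_iff lookup_minus)
lemma fa_of_smul: "fa_smul c (fa_of x) = fa_of (sA c * x)"
  by (simp add: fa_smul_def fun_eq_iff lookup_sA_mult)
lemma fa_of_mon: "fa_mon u = fa_of (Poly_Mapping.single u 1)"
  by (auto simp: fa_mon_def fun_eq_iff lookup_single when_def)

text \<open>Only the splitting point i = length u can contribute. This is the monomial case of
  comparing \<open>fa_mul\<close> with convolution.\<close>

lemma sum_splits_when:
  "(\<Sum>i\<le>length w. (a when u = take i w) * (b when v = drop i w)) = (a * b when u @ v = w)"
  for a b :: complex
proof (cases "u @ v = w")
  case True
  have "(\<Sum>i\<le>length w. (a when u = take i w) * (b when v = drop i w)) =
        (\<Sum>i\<in>{length u}. (a when u = take i w) * (b when v = drop i w))"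
  proof (rule sum.mono_neutral_right)
    show "\<forall>i\<in>{..length w} - {length u}. (a when u = take i w) * (b when v = drop i w) = 0"
    proof
      fix i assume i: "i \<in> {..length w} - {length u}"
      then have "length (take i w) \<noteq> length u" by auto
      then have "u \<noteq> take i w" by metis
      then show "(a when u = take i w) * (b when v = drop i w) = 0" by simp
    qed
  qed (use True in auto)
  then show ?thesis using True by auto
next
  case False
  have "(a when u = take i w) * (b when v = drop i w) = 0" for i
    using False by (auto simp: when_def)
  then show ?thesis using False by (simp only: sum.neutral_const when_simps)
qed

lemma fa_of_mult: "fa_mul (fa_of x) (fa_of y) = fa_of (x * y)"
proof (induction x rule: poly_mapping_add_induct)
  case (single u c)
  show ?case
  proof (induction y rule: poly_mapping_add_induct)
    case (single v d)
    show ?case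
      by (rule ext) (simp add: fa_mul_def mult_single_list lookup_single sum_splits_when)
  next
    case (add y z)
    then show ?case
      by (simp add: fa_mul_def fun_eq_iff lookup_add algebra_simps sum.distrib)
  qed (simp add: fa_mul_def fun_eq_iff)
next
  case (add y z)
  then show ?case
    by (simp add: fa_mul_def fun_eq_iff lookup_add algebra_simps sum.distrib)
qed (simp add: fa_mul_def fun_eq_iff)

lemma fa_of_sum: "fa_sum (\<lambda>a. fa_of (x a)) S = fa_of (\<Sum>a\<in>S. x a)"
  by (simp add: fa_sum_def fun_eq_iff lookup_sum)
lemma fa_of_pow: "fa_pow (fa_of x) n = fa_of (x ^ n)"
  by (induction n) (simp_all add: fa_of_mon fa_of_mult)

definition lc :: "(complex \<times> gen list) list \<Rightarrow> free_alg" where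
  "lc xs = (\<Sum>(c, u)\<leftarrow>xs. Poly_Mapping.single u c)"

lemma fa_of_lc: "fa_lc xs = fa_of (lc xs)"
  by (induction xs) (auto simp: fa_lc_def lc_def fun_eq_iff lookup_add lookup_single when_def)

lemma FA_fa_of: "w \<in> FA \<Longrightarrow> \<exists>x. w = fa_of x"
  by (metis FA_def Abs_poly_mapping_inverse mem_Collect_eq)

lemmas to_fa = fa_of_zero fa_of_add fa_of_diff fa_of_smul fa_of_mon fa_of_mult fa_of_sum fa_of_pow fa_of_lc

definition kA :: free_alg where "kA = Poly_Mapping.single [K1, K2, K2] 1"
definition kiA :: free_alg where "kiA = Poly_Mapping.single [K1i, K2i, K2i] 1"
definition kpow :: "int \<Rightarrow> free_alg" where
  "kpow i = (if 0 \<le> i then kA ^ nat i else kiA ^ nat (- i))"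
definition k2pow :: "int \<Rightarrow> free_alg" where
  "k2pow i = (if 0 \<le> i then gn K2 ^ nat i else gn K2i ^ nat (- i))"

lemma fa_of_Kpow: "Kpow i = fa_of (kpow i)"
  by (simp add: Kpow_def kpow_def K_el_def Kinv_el_def kA_def kiA_def to_fa)
lemma fa_of_K2pow: "K2pow i = fa_of (k2pow i)"
  by (simp add: K2pow_def k2pow_def to_fa)

section \<open>Laurent polynomials\<close>

definition sc :: "complex \<Rightarrow> lp" where "sc c = Poly_Mapping.single (0, 0) c"
definition Kp :: "int \<Rightarrow> lp" where "Kp i = Poly_Mapping.single (i, 0) 1"
definition Cp :: lp where "Cp = Poly_Mapping.single (0, 1) 1"

text \<open>Integer exponents of \<open>C\<^sub>1\<close>, so that multiplication by \<open>C\<^sub>1\<close> is a plain index shift.\<close>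
definition lk :: "lp \<Rightarrow> int \<Rightarrow> int \<Rightarrow> complex" where
  "lk p m c = (if c < 0 then 0 else Poly_Mapping.lookup p (m, nat c))"

lemma lp_eqI: "(\<And>m c. lk p m c = lk p' m c) \<Longrightarrow> p = p'"
proof (rule poly_mapping_eqI)
  fix k :: "int \<times> nat"
  assume *: "\<And>m c. lk p m c = lk p' m c"
  obtain m n where "k = (m, n)" by force
  then show "Poly_Mapping.lookup p k = Poly_Mapping.lookup p' k"
    using *[of m "int n"] by (simp add: lk_def)
qed

lemma lk_add: "lk (p + p') m c = lk p m c + lk p' m c"
  by (simp add: lk_def lookup_add)
lemma lk_diff: "lk (p - p') m c = lk p m c - lk p' m c"
  by (simp add: lk_def lookup_minus)
lemma lk_uminus: "lk (- p) m c = - lk p m c"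
  by (simp add: lk_def)
lemma lk_0: "lk 0 m c = 0"
  by (simp add: lk_def)

lemma lk_sc: "lk (sc x * p) m c = x * lk p m c"
proof (induction p rule: poly_mapping_add_induct)
  case (single k d)
  then show ?case by (simp add: lk_def sc_def mult_single lookup_single when_def flip: zero_prod_def)
qed (simp_all add: lk_add lk_0 algebra_simps)

lemma lk_K: "lk (Kp i * p) m c = lk p (m - i) c"
proof (induction p rule: poly_mapping_add_induct)
  case (single k d)
  then show ?case
    by (cases k) (auto simp: lk_def Kp_def mult_single lookup_single when_def)
qed (simp_all add: lk_add lk_0 algebra_simps)

lemma lk_C: "lk (Cp * p) m c = lk p m (c - 1)"
proof (induction p rule: poly_mapping_add_induct)
  case (single k d)
  then show ?case
    by (cases k) (auto simp: lk_def Cp_def mult_single lookup_single when_def)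
qed (simp_all add: lk_add lk_0 algebra_simps)

lemmas lk_simps = lk_add lk_diff lk_uminus lk_0 lk_sc lk_K lk_C

lemma sc_mult: "sc a * sc b = sc (a * b)" by (simp add: sc_def mult_single)
lemma sc_add: "sc (a + b) = sc a + sc b" by (simp add: sc_def single_add)
lemma sc_diff: "sc (a - b) = sc a - sc b" by (simp add: sc_def single_diff)
lemma sc_uminus: "sc (- b) = - sc b" by (simp add: sc_def single_uminus)
lemma sc_0 [simp]: "sc 0 = 0" by (simp add: sc_def)
lemma sc_1 [simp]: "sc 1 = 1" by (simp add: sc_def flip: zero_prod_def)
lemma Kp_add: "Kp (i + j) = Kp i * Kp j" by (simp add: Kp_def mult_single)
lemma Kp_0 [simp]: "Kp 0 = 1" by (simp add: Kp_def flip: zero_prod_def)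
lemma single_lp: "Poly_Mapping.single (i, m) c = sc c * (Kp i * Cp ^ m)"
proof -
  have "Cp ^ m = Poly_Mapping.single (0, m) 1"
    by (induction m) (simp_all add: Cp_def mult_single flip: zero_prod_def)
  then show ?thesis by (simp add: sc_def Kp_def mult_single)
qed

section \<open>The action of the generators\<close>

type_synonym vec = "int \<Rightarrow> int \<Rightarrow> int \<Rightarrow> lp"

locale whittaker_sl3 =
  fixes q \<alpha> :: complex
  assumes q0: "q \<noteq> 0" and root: "\<And>m::nat. m > 0 \<Longrightarrow> q ^ m \<noteq> 1" and alpha0: "\<alpha> \<noteq> 0"
begin

definition X :: "int \<Rightarrow> complex" where "X e = q powi e"
definition D :: complex where "D = 1 / (q - inverse q)"
definition \<alpha>i :: complex where "\<alpha>i = inverse \<alpha>"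
text \<open>The q-number [b], for integer b.\<close>

definition qn :: "int \<Rightarrow> complex" where "qn b = (X b - X (- b)) * D"

lemma q_sq: "q * q \<noteq> 1"
  using root[of 2] by (simp add: power2_eq_square)

lemma X_add: "X (a + b) = X a * X b"
  using q0 by (simp add: X_def power_int_add)

lemma X_0 [simp]: "X 0 = 1" by (simp add: X_def)

lemma X_nonzero [simp]: "X a \<noteq> 0"
  using q0 by (simp add: X_def)

lemma X_norm:
  "X (a - b) = X a * X (- b)" "X (- (a + b)) = X (- a) * X (- b)" "X (- (a - b)) = X (- a) * X b"
  "X (- (- a)) = X a" "X (2 * a) = X a * X a" "X (- (2 * a)) = X (- a) * X (- a)"
  "X (- 2 * a) = X (- a) * X (- a)"
  using X_add[of a "-b"] X_add[of "-a" "-b"] X_add[of "-a" "b"] X_add[of a a] X_add[of "-a" "-a"]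
  by simp_all

lemma X_numeral:
  "X 2 = X 1 * X 1" "X 3 = X 1 * (X 1 * X 1)" "X (- 2) = X (- 1) * X (- 1)"
  "X (- 3) = X (- 1) * (X (- 1) * X (- 1))"
  using X_add[of 1 1] X_add[of 2 1] X_add[of "-1" "-1"] X_add[of "-2" "-1"] by simp_all

lemma D_eq: "D * (q * q - 1) = q"
  using q0 q_sq unfolding D_def by (simp add: field_simps)

lemma D_nonzero [simp]: "D \<noteq> 0"
  using D_eq q0 by auto

text \<open>Both say D (q - q^(-1)) = 1, oriented so that next to \<open>D\<close> neither q^2 nor
  q^(-1) survives.\<close>

lemma D_X: "D * (X 1 * X 1) = D + X 1" "D * X (- 1) = D * X 1 - 1"
  using D_eq q0 by (auto simp: X_def power_int_minus field_simps)

text \<open>The generators act on \<open>\<Sum> F\<^sub>2\<^sup>a F\<^sub>3\<^sup>b K\<^sub>2\<^sup>j f(a,b,j) v\<close>, where \<open>f(a,b,j)\<close> is a Laurent polynomial.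
  The formulas make sense for negative \<open>a\<close> and \<open>b\<close> as well (with \<open>F\<^sub>2\<close> and \<open>F\<^sub>3\<close> inverted),
  which avoids truncated exponents.\<close>

primrec op :: "gen \<Rightarrow> vec \<Rightarrow> vec" where
  "op E1 f = (\<lambda>a b j. sc (\<alpha> * X j) * f a b j + sc (qn (b + 1)) * (Kp (- 1) * f (a - 1) (b + 1) (j - 2)))"
| "op E2 f = (\<lambda>a b j.
     sc (X (1 - b - j) * \<alpha>i * qn (b + 1)) *
       (sc (D * D * X (- 1)) * (Kp 1 * f a (b + 1) (j + 1)) + sc (D * D * X 1) * (Kp (- 1) * f a (b + 1) (j - 3))
        - Cp * f a (b + 1) (j - 1))
     + sc (qn (a + 1) * D) * (sc (X (- a - b)) * f (a + 1) b (j - 1) - sc (X (a + b)) * f (a + 1) b (j + 1)))"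
| "op F1 f = (\<lambda>a b j.
     sc (X (a - b - j) * \<alpha>i) *
       (Cp * f a b j - sc (D * D * X (- 1)) * (Kp 1 * f a b (j + 2)) - sc (D * D * X 1) * (Kp (- 1) * f a b (j - 2)))
     + sc (qn (a + 1)) * f (a + 1) (b - 1) j)"
| "op F2 f = (\<lambda>a b j. f (a - 1) b j)"
| "op K1 f = (\<lambda>a b j. sc (X (a - b)) * (Kp 1 * f a b (j + 2)))"
| "op K1i f = (\<lambda>a b j. sc (X (b - a)) * (Kp (- 1) * f a b (j - 2)))"
| "op K2 f = (\<lambda>a b j. sc (X (- 2 * a - b)) * f a b (j - 1))"
| "op K2i f = (\<lambda>a b j. sc (X (2 * a + b)) * f a b (j + 1))"

text \<open>Closed form of E_1 E_2 - q E_2 E_1. With it and \<open>opF3\<close> the cubic Serre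
  relations split into q-commutation rules between two operators, so that only compositions of
  length two have to be expanded.\<close>

definition opE3 :: "vec \<Rightarrow> vec" where
  "opE3 f = (\<lambda>a b j.
     sc (D * D * (X (- b) * X (- b) - X 1 * X 1)) * (Kp 1 * f a (b + 1) (j + 1))
   + sc (D * D * X a * X a * (X b * X b * X 1 * X 1 - 1)) * (Kp (- 1) * f a (b + 1) (j - 1))
   + sc (\<alpha> * D * X j * X b * (X 1 * X 1 * X a * X a - 1)) * f (a + 1) b (j + 1))"

text \<open>Closed form of F_1 F_2 - q F_2 F_1; the factor q^(-a) comes from moving F_3 past
  F_2^a.\<close>

definition opF3 :: "vec \<Rightarrow> vec" where
  "opF3 f = (\<lambda>a b j. sc (X (- a)) * f a (b - 1) j)"

definition vadd :: "vec \<Rightarrow> vec \<Rightarrow> vec" where "vadd f g = (\<lambda>a b j. f a b j + g a b j)"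
definition vsc :: "complex \<Rightarrow> vec \<Rightarrow> vec" where "vsc c f = (\<lambda>a b j. sc c * f a b j)"

lemma inv_mult_left: "x * y = 1 \<Longrightarrow> x * (y * z) = (z :: complex)"
  by (metis mult.assoc mult_1)

lemmas op_defs = op.simps opE3_def opF3_def vadd_def vsc_def

lemma op_relations:
  shows op_E1_F1: "op E1 (op F1 f) = vadd (op F1 (op E1 f)) (vadd (vsc D (op K1 f)) (vsc (- D) (op K1i f)))"
    and op_E2_F1: "op E2 (op F1 f) = op F1 (op E2 f)"
    and op_E1_F2: "op E1 (op F2 f) = op F2 (op E1 f)"
    and op_E2_F2: "op E2 (op F2 f) = vadd (op F2 (op E2 f)) (vadd (vsc D (op K2 f)) (vsc (- D) (op K2i f)))"
    and op_F1_F2: "op F1 (op F2 f) = vadd (vsc (X 1) (op F2 (op F1 f))) (opF3 f)"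
    and op_F1_F3: "op F1 (opF3 f) = vsc (X (- 1)) (opF3 (op F1 f))"
    and op_F3_F2: "opF3 (op F2 f) = vsc (X (- 1)) (op F2 (opF3 f))"
    and op_E1_E2: "op E1 (op E2 f) = vadd (vsc (X 1) (op E2 (op E1 f))) (opE3 f)"
    and op_E1_E3: "op E1 (opE3 f) = vsc (X (- 1)) (opE3 (op E1 f))"
    and op_E3_E2: "opE3 (op E2 f) = vsc (X (- 1)) (op E2 (opE3 f))"
    and op_K_inverse: "op K1 (op K1i f) = f"
      "op K1i (op K1 f) = f"
      "op K2 (op K2i f) = f"
      "op K2i (op K2 f) = f"
    and op_K1_K2: "op K1 (op K2 f) = op K2 (op K1 f)"
    and op_K_E: "op K1 (op E1 f) = vsc (X 1 * X 1) (op E1 (op K1 f))"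
      "op K1 (op E2 f) = vsc (X (- 1)) (op E2 (op K1 f))"
      "op K2 (op E1 f) = vsc (X (- 1)) (op E1 (op K2 f))"
      "op K2 (op E2 f) = vsc (X 1 * X 1) (op E2 (op K2 f))"
      "op K1i (op E1 f) = vsc (X (- 1) * X (- 1)) (op E1 (op K1i f))"
      "op K1i (op E2 f) = vsc (X 1) (op E2 (op K1i f))"
      "op K2i (op E1 f) = vsc (X 1) (op E1 (op K2i f))"
      "op K2i (op E2 f) = vsc (X (- 1) * X (- 1)) (op E2 (op K2i f))"
    and op_K_F: "op K1 (op F1 f) = vsc (X (- 1) * X (- 1)) (op F1 (op K1 f))"
      "op K1 (op F2 f) = vsc (X 1) (op F2 (op K1 f))"
      "op K2 (op F1 f) = vsc (X 1) (op F1 (op K2 f))"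
      "op K2 (op F2 f) = vsc (X (- 1) * X (- 1)) (op F2 (op K2 f))"
      "op K1i (op F1 f) = vsc (X 1 * X 1) (op F1 (op K1i f))"
      "op K1i (op F2 f) = vsc (X (- 1)) (op F2 (op K1i f))"
      "op K2i (op F1 f) = vsc (X (- 1)) (op F1 (op K2i f))"
      "op K2i (op F2 f) = vsc (X 1 * X 1) (op F2 (op K2i f))"
proof -
  txt \<open>Every identity is checked on coefficients, where it says that finitely many shifts of \<open>f\<close> cancel.
    With \<open>q\<^sup>a\<close>, \<open>q\<^sup>b\<close>, \<open>q\<^sup>j\<close>, \<open>q\<close>, \<open>1/(q - q\<inverse>)\<close> and their inverses as unknowns, the rules \<open>R\<close> are a
    confluent rewrite system for the relations between them.\<close>
  have lp_ext: "f = g" if "\<And>a b j m c. lk (f a b j) m c = lk (g a b j) m c" for f g :: vec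
    using that by (intro ext lp_eqI)
  define u1 u2 u3 where u: "u1 = D" "u2 = X 1" "u3 = X (- 1)"
  define a2 where aa: "a2 = \<alpha>i"
  have nu: "u2 * u3 = 1" "\<alpha> * a2 = 1"
    using X_add[of 1 "-1"] alpha0 by (auto simp: aa u \<alpha>i_def)
  have du: "u1 * (u2 * u2) = u1 + u2" "u1 * u3 = u1 * u2 - 1"
    using D_X by (auto simp: u)
  \<comment> \<open>Versions with a trailing factor, so that the rules also fire inside right-nested
    products.\<close>
  have du': "u1 * (u2 * (u2 * z)) = u1 * z + u2 * z" "u1 * (u3 * z) = u1 * (u2 * z) - z" for z
    using arg_cong[OF du(1), of "\<lambda>x. x * z"] arg_cong[OF du(2), of "\<lambda>x. x * z"]
    by (simp_all add: algebra_simps)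
  note S = op_defs lk_simps qn_def X_add X_norm X_numeral X_0 mult_1 mult_1_right
  {
    fix a b j m c
    define x1 y1 t1 x2 y2 t2 where v: "x1 = X a" "y1 = X b" "t1 = X j"
      "x2 = X (- a)" "y2 = X (- b)" "t2 = X (- j)"
    have n: "x1 * x2 = 1" "y1 * y2 = 1" "t1 * t2 = 1"
      using X_add[of a "-a"] X_add[of b "-b"] X_add[of j "-j"] by (auto simp: v)
    note R = n n[THEN inv_mult_left] nu nu[THEN inv_mult_left] du du'
    note S2 = v[symmetric] u[symmetric] aa[symmetric]
    have
      "lk ((op E1 (op F1 f)) a b j) m c = lk ((vadd (op F1 (op E1 f)) (vadd (vsc D (op K1 f)) (vsc (- D) (op K1i f)))) a b j) m c"
      "lk ((op E2 (op F1 f)) a b j) m c = lk ((op F1 (op E2 f)) a b j) m c"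
      "lk ((op E1 (op F2 f)) a b j) m c = lk ((op F2 (op E1 f)) a b j) m c"
      "lk ((op E2 (op F2 f)) a b j) m c = lk ((vadd (op F2 (op E2 f)) (vadd (vsc D (op K2 f)) (vsc (- D) (op K2i f)))) a b j) m c"
      "lk ((op F1 (op F2 f)) a b j) m c = lk ((vadd (vsc (X 1) (op F2 (op F1 f))) (opF3 f)) a b j) m c"
      "lk ((op F1 (opF3 f)) a b j) m c = lk ((vsc (X (- 1)) (opF3 (op F1 f))) a b j) m c"
      "lk ((opF3 (op F2 f)) a b j) m c = lk ((vsc (X (- 1)) (op F2 (opF3 f))) a b j) m c"
      "lk ((op E1 (op E2 f)) a b j) m c = lk ((vadd (vsc (X 1) (op E2 (op E1 f))) (opE3 f)) a b j) m c"
      "lk ((op E1 (opE3 f)) a b j) m c = lk ((vsc (X (- 1)) (opE3 (op E1 f))) a b j) m c"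
      "lk ((opE3 (op E2 f)) a b j) m c = lk ((vsc (X (- 1)) (op E2 (opE3 f))) a b j) m c"
      "lk ((op K1 (op K1i f)) a b j) m c = lk (f a b j) m c"
      "lk ((op K1i (op K1 f)) a b j) m c = lk (f a b j) m c"
      "lk ((op K2 (op K2i f)) a b j) m c = lk (f a b j) m c"
      "lk ((op K2i (op K2 f)) a b j) m c = lk (f a b j) m c"
      "lk ((op K1 (op K2 f)) a b j) m c = lk ((op K2 (op K1 f)) a b j) m c"
      "lk ((op K1 (op E1 f)) a b j) m c = lk ((vsc (X 1 * X 1) (op E1 (op K1 f))) a b j) m c"
      "lk ((op K1 (op E2 f)) a b j) m c = lk ((vsc (X (- 1)) (op E2 (op K1 f))) a b j) m c"
      "lk ((op K2 (op E1 f)) a b j) m c = lk ((vsc (X (- 1)) (op E1 (op K2 f))) a b j) m c"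
      "lk ((op K2 (op E2 f)) a b j) m c = lk ((vsc (X 1 * X 1) (op E2 (op K2 f))) a b j) m c"
      "lk ((op K1i (op E1 f)) a b j) m c = lk ((vsc (X (- 1) * X (- 1)) (op E1 (op K1i f))) a b j) m c"
      "lk ((op K1i (op E2 f)) a b j) m c = lk ((vsc (X 1) (op E2 (op K1i f))) a b j) m c"
      "lk ((op K2i (op E1 f)) a b j) m c = lk ((vsc (X 1) (op E1 (op K2i f))) a b j) m c"
      "lk ((op K2i (op E2 f)) a b j) m c = lk ((vsc (X (- 1) * X (- 1)) (op E2 (op K2i f))) a b j) m c"
      "lk ((op K1 (op F1 f)) a b j) m c = lk ((vsc (X (- 1) * X (- 1)) (op F1 (op K1 f))) a b j) m c"
      "lk ((op K1 (op F2 f)) a b j) m c = lk ((vsc (X 1) (op F2 (op K1 f))) a b j) m c"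
      "lk ((op K2 (op F1 f)) a b j) m c = lk ((vsc (X 1) (op F1 (op K2 f))) a b j) m c"
      "lk ((op K2 (op F2 f)) a b j) m c = lk ((vsc (X (- 1) * X (- 1)) (op F2 (op K2 f))) a b j) m c"
      "lk ((op K1i (op F1 f)) a b j) m c = lk ((vsc (X 1 * X 1) (op F1 (op K1i f))) a b j) m c"
      "lk ((op K1i (op F2 f)) a b j) m c = lk ((vsc (X (- 1)) (op F2 (op K1i f))) a b j) m c"
      "lk ((op K2i (op F1 f)) a b j) m c = lk ((vsc (X (- 1)) (op F1 (op K2i f))) a b j) m c"
      "lk ((op K2i (op F2 f)) a b j) m c = lk ((vsc (X 1 * X 1) (op F2 (op K2i f))) a b j) m c"
      by (simp only: S; (simp only: S2)?; simp add: algebra_simps R)+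
  }
  note coefficients = this
  show
    "op E1 (op F1 f) = vadd (op F1 (op E1 f)) (vadd (vsc D (op K1 f)) (vsc (- D) (op K1i f)))"
    "op E2 (op F1 f) = op F1 (op E2 f)"
    "op E1 (op F2 f) = op F2 (op E1 f)"
    "op E2 (op F2 f) = vadd (op F2 (op E2 f)) (vadd (vsc D (op K2 f)) (vsc (- D) (op K2i f)))"
    "op F1 (op F2 f) = vadd (vsc (X 1) (op F2 (op F1 f))) (opF3 f)"
    "op F1 (opF3 f) = vsc (X (- 1)) (opF3 (op F1 f))"
    "opF3 (op F2 f) = vsc (X (- 1)) (op F2 (opF3 f))"
    "op E1 (op E2 f) = vadd (vsc (X 1) (op E2 (op E1 f))) (opE3 f)"
    "op E1 (opE3 f) = vsc (X (- 1)) (opE3 (op E1 f))"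
    "opE3 (op E2 f) = vsc (X (- 1)) (op E2 (opE3 f))"
    "op K1 (op K1i f) = f"
    "op K1i (op K1 f) = f"
    "op K2 (op K2i f) = f"
    "op K2i (op K2 f) = f"
    "op K1 (op K2 f) = op K2 (op K1 f)"
    "op K1 (op E1 f) = vsc (X 1 * X 1) (op E1 (op K1 f))"
    "op K1 (op E2 f) = vsc (X (- 1)) (op E2 (op K1 f))"
    "op K2 (op E1 f) = vsc (X (- 1)) (op E1 (op K2 f))"
    "op K2 (op E2 f) = vsc (X 1 * X 1) (op E2 (op K2 f))"
    "op K1i (op E1 f) = vsc (X (- 1) * X (- 1)) (op E1 (op K1i f))"
    "op K1i (op E2 f) = vsc (X 1) (op E2 (op K1i f))"
    "op K2i (op E1 f) = vsc (X 1) (op E1 (op K2i f))"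
    "op K2i (op E2 f) = vsc (X (- 1) * X (- 1)) (op E2 (op K2i f))"
    "op K1 (op F1 f) = vsc (X (- 1) * X (- 1)) (op F1 (op K1 f))"
    "op K1 (op F2 f) = vsc (X 1) (op F2 (op K1 f))"
    "op K2 (op F1 f) = vsc (X 1) (op F1 (op K2 f))"
    "op K2 (op F2 f) = vsc (X (- 1) * X (- 1)) (op F2 (op K2 f))"
    "op K1i (op F1 f) = vsc (X 1 * X 1) (op F1 (op K1i f))"
    "op K1i (op F2 f) = vsc (X (- 1)) (op F2 (op K1i f))"
    "op K2i (op F1 f) = vsc (X (- 1)) (op F1 (op K2i f))"
    "op K2i (op F2 f) = vsc (X 1 * X 1) (op F2 (op K2i f))"
    by (rule lp_ext, rule coefficients)+
qed


section \<open>The free algebra acts, and the relations act as zero\<close>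

definition vmul :: "lp \<Rightarrow> vec \<Rightarrow> vec" where "vmul P f = (\<lambda>a b j. P * f a b j)"
definition v0 :: vec where "v0 = (\<lambda>a b j. 0)"

lemma op_vadd: "op x (vadd f g) = vadd (op x f) (op x g)"
  by (cases x) (auto simp: op.simps vadd_def algebra_simps intro!: ext)

text \<open>Multiplication of coefficients is an endomorphism of the module; this is what makes
  computing modulo an ideal of coefficients compatible with the action.\<close>

lemma op_vmul: "op x (vmul P f) = vmul P (op x f)"
  by (cases x) (auto simp: op.simps vmul_def algebra_simps intro!: ext)

declare op.simps [simp del]

lemma vsc_vmul: "vsc c = vmul (sc c)"
  by (simp add: vsc_def vmul_def fun_eq_iff)

lemma op_vsc: "op x (vsc c f) = vsc c (op x f)"
  by (simp add: vsc_vmul op_vmul)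

primrec opw :: "gen list \<Rightarrow> vec \<Rightarrow> vec" where
  "opw [] f = f"
| "opw (x # w) f = op x (opw w f)"

lemma opw_append: "opw (u @ w) f = opw u (opw w f)"
  by (induction u) auto

lemma opw_vadd: "opw w (vadd f g) = vadd (opw w f) (opw w g)"
  by (induction w) (auto simp: op_vadd)

lemma opw_vmul: "opw w (vmul P f) = vmul P (opw w f)"
  by (induction w) (auto simp: op_vmul)

definition act :: "free_alg \<Rightarrow> vec \<Rightarrow> vec" where
  "act x f = (\<lambda>a b j. pm_lift (\<lambda>w c. sc c * opw w f a b j) x)"

lemma act_add: "act (x + y) f = vadd (act x f) (act y f)"
  by (auto simp: act_def vadd_def sc_add algebra_simps intro!: ext pm_lift_add)

lemma act_single: "act (Poly_Mapping.single w c) f = vsc c (opw w f)"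
  by (simp add: act_def vsc_def)

lemma act_zero: "act 0 f = v0"
  by (simp add: act_def v0_def)

lemma act_vadd: "act x (vadd f g) = vadd (act x f) (act x g)"
  by (induction x rule: poly_mapping_add_induct; simp add: act_zero act_single act_add opw_vadd;
      simp add: v0_def vadd_def vsc_def algebra_simps)

lemma act_vmul: "act x (vmul P f) = vmul P (act x f)"
  by (induction x rule: poly_mapping_add_induct; simp add: act_zero act_single act_add opw_vmul;
      simp add: v0_def vadd_def vsc_def vmul_def algebra_simps)

lemma act_mult: "act (x * y) f = act x (act y f)"
proof (induction x rule: poly_mapping_add_induct)
  case (single u c)
  show ?case
  proof (induction y rule: poly_mapping_add_induct)
    case zero
    have "opw u v0 = v0"
      using opw_vmul[of u 0 v0] by (simp add: vmul_def v0_def)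
    then show ?case by (simp add: act_zero act_single vsc_def v0_def)
  next
    case (single v d)
    then show ?case
      by (simp add: act_single mult_single_list opw_append vsc_vmul opw_vmul)
         (simp add: vmul_def fun_eq_iff mult.assoc flip: sc_mult)
  next
    case (add y z)
    then show ?case by (simp add: distrib_left act_add act_vadd)
  qed
next
  case (add x y)
  then show ?case by (simp add: distrib_right act_add)
qed (simp add: act_zero)

lemma act_gn: "act (gn x) f = op x f"
  by (simp add: act_single vsc_def)

lemma act_sA: "act (sA c) f = vsc c f"
  by (simp add: act_single)

lemma act_diff: "act (x - y) f a b j = act x f a b j - act y f a b j"
proof -
  have "act x f = vadd (act (x - y) f) (act y f)"
    by (simp flip: act_add)
  then show ?thesis by (simp add: vadd_def)
qed

lemma act_of_v0: "act x v0 = v0"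
  using act_vmul[of x 0 v0] by (simp add: vmul_def v0_def)

lemma act_lc: "act (lc xs) f a b j = (\<Sum>(c, u)\<leftarrow>xs. sc c * opw u f a b j)"
  by (induction xs) (auto simp: lc_def act_add act_single vadd_def vsc_def act_zero v0_def)

lemma X_q: "X 1 = q" "X (- 1) = inverse q" "D * z = z / (q - inverse q)"
  by (simp_all add: X_def D_def power_int_minus)

lemma sc_q:
  "sc q * sc (inverse q) = 1" "sc q * (sc (inverse q) * p) = p"
  using q0 by (simp_all add: sc_mult flip: mult.assoc)

text \<open>The existential records finite support: relations are functions on words, whereas
  \<open>act\<close> is defined on ring elements.\<close>

lemma rels_act_zero:
  assumes "r \<in> uq_rels q"
  shows "\<exists>x. r = fa_of x \<and> (\<forall>f. act x f = v0)"
proof -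
  have *: "\<exists>x. fa_lc xs = fa_of x \<and> (\<forall>f. act x f = v0)"
    if "\<And>f a b j. (\<Sum>(c, u)\<leftarrow>xs. sc c * opw u f a b j) = 0" for xs
    using that by (intro exI[of _ "lc xs"]) (auto simp: fa_of_lc act_lc v0_def fun_eq_iff)
  have D_dual: "1 / (q - inverse q) = D" "- 1 / (q - inverse q) = - D"
    by (simp_all add: D_def)
  show ?thesis
    using assms unfolding uq_rels_def
    apply (elim UnE)
    subgoal by (auto simp: Kg_def Kig_def op_relations sc_uminus intro!: *)
    subgoal by (auto simp: Kg_def Kig_def op_relations sc_uminus intro!: *)
    subgoal by (auto simp: op_relations sc_uminus intro!: *)
    subgoal by (clarsimp, elim disjE; simp; intro *; simp add: Eg_def Fg_def Kg_def Kig_def D_dual op_relations vadd_def vsc_def sc_uminus)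
    subgoal by (clarsimp, elim disjE; simp; intro *; simp add: Eg_def Fg_def Kg_def Kig_def cartan_def X_q(1,2) power2_eq_square power_int_minus op_relations vadd_def vsc_def sc_uminus)
    subgoal by (clarsimp, elim disjE; simp; intro *; simp add: Eg_def Fg_def Kg_def Kig_def cartan_def X_q(1,2) power2_eq_square power_int_minus op_relations vadd_def vsc_def sc_uminus)
    subgoal by (clarsimp, elim disjE; simp; intro *; simp add: Eg_def Fg_def Kg_def Kig_def cartan_def X_q(1,2) power2_eq_square power_int_minus op_relations vadd_def vsc_def sc_uminus)
    subgoal by (clarsimp, elim disjE; simp; intro *; simp add: Eg_def Fg_def Kg_def Kig_def cartan_def X_q(1,2) power2_eq_square power_int_minus op_relations vadd_def vsc_def sc_uminus)
    \<comment> \<open>Serre relations: the q-commutation rules with \<open>opE3\<close> (below,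
      \<open>opF3\<close>) order all words alike, after which the coefficient q + q^(-1)
      cancels.\<close>
    subgoal by (clarsimp, elim disjE; simp; intro *; simp add: Eg_def op_relations op_vadd op_vsc; simp add: vadd_def vsc_def sc_uminus sc_diff X_q(1,2) algebra_simps sc_q)
    subgoal by (clarsimp, elim disjE; simp; intro *; simp add: Fg_def op_relations op_vadd op_vsc; simp add: vadd_def vsc_def sc_uminus sc_diff X_q(1,2) algebra_simps sc_q)
    done
qed

lemma uq_ideal_act_zero:
  assumes "r \<in> uq_ideal q"
  shows "\<exists>x. r = fa_of x \<and> (\<forall>f. act x f = v0)"
  using assms
proof induction
  case (rel r)
  then show ?case by (rule rels_act_zero)
next
  case zero
  then show ?case by (metis fa_of_zero act_zero)
next
  case (add a b)
  then show ?case by (auto simp: fa_of_add act_add vadd_def v0_def)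
next
  case (smul a c)
  then show ?case by (auto simp: fa_of_smul act_mult act_of_v0)
next
  case (lmul a x)
  then show ?case by (auto simp: fa_of_mon fa_of_mult act_mult act_of_v0)
next
  case (rmul a x)
  then show ?case by (auto simp: fa_of_mon fa_of_mult act_mult act_of_v0)
qed

end

section \<open>Ideals of the coefficient ring\<close>

lemma ideal_zero: "is_ideal I \<Longrightarrow> 0 \<in> I"
  and ideal_add: "is_ideal I \<Longrightarrow> a \<in> I \<Longrightarrow> b \<in> I \<Longrightarrow> a + b \<in> I"
  and ideal_mult: "is_ideal I \<Longrightarrow> a \<in> I \<Longrightarrow> r * a \<in> I"
  by (auto simp: is_ideal_def)

lemma ideal_diff: "is_ideal I \<Longrightarrow> a \<in> I \<Longrightarrow> b \<in> I \<Longrightarrow> a - b \<in> I"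
  using ideal_add[of I a "- 1 * b"] ideal_mult[of I b "- 1"] by simp

lemma ideal_unscale: "is_ideal I \<Longrightarrow> sc c * a \<in> I \<Longrightarrow> c \<noteq> 0 \<Longrightarrow> a \<in> I"
  using ideal_mult[of I "sc c * a" "sc (inverse c)"] by (simp add: sc_mult flip: mult.assoc)

lemma ideal_unshift: "is_ideal I \<Longrightarrow> Kp i * a \<in> I \<Longrightarrow> a \<in> I"
  using ideal_mult[of I "Kp i * a" "Kp (- i)"] by (simp flip: mult.assoc Kp_add)

lemmas ideal_intros = ideal_zero ideal_add ideal_mult ideal_diff

lemma ideal_singleton_zero: "is_ideal {0}"
  by (simp add: is_ideal_def)

context whittaker_sl3
begin

section \<open>Coordinates of elements of the free algebra\<close>

definition f3A :: free_alg where "f3A = lc [(1, [F1, F2]), (- q, [F2, F1])]"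
definition c1A :: free_alg where
  "c1A = lc [(1, [F1, E1]), (q / (q - inverse q)^2, [K1]), (inverse q / (q - inverse q)^2, [K1i])]"
definition evA :: "lp \<Rightarrow> free_alg" where
  "evA Q = pm_lift (\<lambda>(i, m) c. sA c * (kpow i * c1A ^ m)) Q"
definition mon :: "nat \<Rightarrow> nat \<Rightarrow> int \<Rightarrow> free_alg" where
  "mon a b j = gn F2 ^ a * (f3A ^ b * k2pow j)"

lemma fa_of_F3: "F3_el q = fa_of f3A"
  by (simp add: F3_el_def f3A_def fa_of_lc)
lemma fa_of_C1: "C1_el q = fa_of c1A"
  by (simp add: C1_el_def c1A_def fa_of_lc)
lemma fa_of_ev: "lp_ev q Q = fa_of (evA Q)"
proof -
  have "lp_ev q Q = fa_sum (\<lambda>k. fa_of ((\<lambda>(i, m) c. sA c * (kpow i * c1A ^ m)) k (Poly_Mapping.lookup Q k))) (Poly_Mapping.keys Q)"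
    unfolding lp_ev_def by (rule arg_cong2[where f = fa_sum]) (auto simp: fun_eq_iff to_fa fa_of_C1 fa_of_Kpow)
  then show ?thesis
    by (simp add: fa_of_sum evA_def pm_lift_def)
qed

lemma evA_add: "evA (P + Q) = evA P + evA Q"
  unfolding evA_def by (rule pm_lift_add) (auto simp: single_add algebra_simps)
lemma evA_zero [simp]: "evA 0 = 0"
  by (simp add: evA_def)
lemma evA_single: "evA (Poly_Mapping.single (i, m) c) = sA c * (kpow i * c1A ^ m)"
  unfolding evA_def by (subst pm_lift_single) auto
lemma evA_one [simp]: "evA 1 = 1"
  using evA_single[of 0 0 1] by (simp add: kpow_def flip: zero_prod_def)

text \<open>The coordinates of F_2^a F_3^b K_2^j P v; in particular \<open>eb 0 0 0 1\<close> stands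
  for v.\<close>

definition eb :: "int \<Rightarrow> int \<Rightarrow> int \<Rightarrow> lp \<Rightarrow> vec" where
  "eb a b j P = (\<lambda>a' b' j'. if a' = a \<and> b' = b \<and> j' = j then P else 0)"

lemma X_inv: "X a * X (- a) = 1" "X (- a) * X a = 1" "X a * (X (- a) * z) = z" "X (- a) * (X a * z) = z"
proof -
  show 1: "X a * X (- a) = 1" using X_add[of a "- a"] by simp
  then show "X (- a) * X a = 1" by (simp only: mult.commute)
  with 1 show "X a * (X (- a) * z) = z" "X (- a) * (X a * z) = z"
    by (simp_all only: mult.assoc[symmetric] mult_1)
qed

lemma qn_0 [simp]: "qn 0 = 0" by (simp add: qn_def)
lemma qn_1 [simp]: "qn 1 = 1"
  using D_X by (simp add: qn_def algebra_simps)

lemma eb_F2: "op F2 (eb a b j P) = eb (a + 1) b j P"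
  by (auto simp: op.simps eb_def fun_eq_iff)
lemma eb_K2: "op K2 (eb a b j P) = eb a b (j + 1) (sc (X (- 2 * a - b)) * P)"
  by (auto simp: op.simps eb_def fun_eq_iff)
lemma eb_K2i: "op K2i (eb a b j P) = eb a b (j - 1) (sc (X (2 * a + b)) * P)"
  by (auto simp: op.simps eb_def fun_eq_iff)
lemma eb_K1: "op K1 (eb a b j P) = eb a b (j - 2) (sc (X (a - b)) * (Kp 1 * P))"
  by (auto simp: op.simps eb_def fun_eq_iff)
lemma eb_K1i: "op K1i (eb a b j P) = eb a b (j + 2) (sc (X (b - a)) * (Kp (- 1) * P))"
  by (auto simp: op.simps eb_def fun_eq_iff)
lemma eb_F3: "opF3 (eb 0 b j P) = eb 0 (b + 1) j P"
  by (auto simp: opF3_def eb_def fun_eq_iff)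

lemma eb_E1: "op E1 (eb 0 0 0 P) = eb 0 0 0 (sc \<alpha> * P)"
  by (auto simp: op.simps eb_def fun_eq_iff)
lemma eb_E2: "op E2 (eb 0 0 0 P) = v0"
  by (auto simp: op.simps eb_def fun_eq_iff v0_def)

lemma act_f3: "act f3A f = opF3 f"
  using X_q(1) by (auto simp: f3A_def act_lc fun_eq_iff op_F1_F2 vadd_def vsc_def sc_uminus)

text \<open>\<open>op F1\<close> was defined by solving C_1 v for F_1 v, so the torus terms of C_1
  cancel those of F_1 E_1 and the factor \<alpha> from E_1 cancels \<open>\<alpha>i\<close>.\<close>

lemma eb_C1: "act c1A (eb 0 0 0 P) = eb 0 0 0 (Cp * P)"
proof -
  have D2: "q / (q - inverse q)\<^sup>2 = D * D * X 1" "inverse q / (q - inverse q)\<^sup>2 = D * D * X (- 1)"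
    by (simp_all add: D_def X_q power2_eq_square)
  have inv: "\<alpha> * \<alpha>i = 1" "\<alpha> * (\<alpha>i * z) = z" for z
    using alpha0 by (simp_all add: \<alpha>i_def)
  have F1: "op F1 (eb 0 0 0 (sc \<alpha> * P)) a b j = (if a = 0 \<and> b = 0 then
     (if j = 0 then Cp * P else if j = - 2 then - sc (D * D * X 1) * (Kp 1 * P)
      else if j = 2 then - sc (D * D * X (- 1)) * (Kp (- 1) * P) else 0) else 0)" for a b j
    by (rule lp_eqI) (auto simp: op.simps eb_def lk_simps inv X_numeral X_inv mult_ac[where 'a = complex])
  show ?thesis
    by (auto simp: c1A_def act_lc fun_eq_iff eb_E1 D2 F1 eb_K1 eb_K1i) (auto simp: eb_def)
qed

lemma act_one: "act 1 f = f"
  using act_sA[of 1 f] by (simp add: vsc_def)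

lemma act_pow: "act (x ^ n) f = (act x ^^ n) f"
  by (induction n) (simp_all add: act_one act_mult)

lemma eb_k2pow: "act (k2pow i) (eb a b j P) = eb a b (j + i) (sc (X (i * (- 2 * a - b))) * P)"
proof -
  have 1: "(op K2 ^^ n) (eb a b j P) = eb a b (j + int n) (sc (X (int n * (- 2 * a - b))) * P)" for n
  proof (induction n)
    case (Suc n)
    have "sc (X (- 2 * a - b)) * (sc (X (int n * (- 2 * a - b))) * P) = sc (X (int (Suc n) * (- 2 * a - b))) * P"
      by (simp add: sc_mult flip: mult.assoc X_add) (simp add: algebra_simps)
    with Suc show ?case by (simp add: eb_K2 algebra_simps)
  qed simp
  have 2: "(op K2i ^^ n) (eb a b j P) = eb a b (j - int n) (sc (X (int n * (2 * a + b))) * P)" for n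
  proof (induction n)
    case (Suc n)
    have "sc (X (2 * a + b)) * (sc (X (int n * (2 * a + b))) * P) = sc (X (int (Suc n) * (2 * a + b))) * P"
      by (simp add: sc_mult flip: mult.assoc X_add) (simp add: algebra_simps)
    with Suc show ?case by (simp add: eb_K2i algebra_simps)
  qed simp
  show ?thesis
  proof (cases "0 \<le> i")
    case True
    then show ?thesis using 1[of "nat i"] by (simp add: k2pow_def act_pow act_gn[abs_def])
  next
    case False
    have "- i * (2 * a + b) = i * (- 2 * a - b)" by (simp add: algebra_simps)
    with False show ?thesis using 2[of "nat (- i)"]
      by (simp add: k2pow_def act_pow act_gn[abs_def])
  qed
qed

lemma eb_kA: "act kA (eb 0 0 j P) = eb 0 0 j (Kp 1 * P)"
  by (simp add: kA_def act_single eb_K1 eb_K2 vsc_def)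
lemma eb_kiA: "act kiA (eb 0 0 j P) = eb 0 0 j (Kp (- 1) * P)"
  by (simp add: kiA_def act_single eb_K1i eb_K2i vsc_def)

lemma eb_kpow: "act (kpow i) (eb 0 0 j P) = eb 0 0 j (Kp i * P)"
proof -
  have 1: "(act kA ^^ n) (eb 0 0 j P) = eb 0 0 j (Kp (int n) * P)" for n
    by (induction n) (simp_all add: eb_kA add.commute Kp_add mult.assoc)
  have 2: "(act kiA ^^ n) (eb 0 0 j P) = eb 0 0 j (Kp (- int n) * P)" for n
    by (induction n) (simp_all add: eb_kiA flip: mult.assoc Kp_add)
  show ?thesis
    using 1[of "nat i"] 2[of "nat (- i)"] by (auto simp: kpow_def act_pow)
qed

lemma eb_vmul: "vmul R (eb a b j P) = eb a b j (R * P)"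
  by (auto simp: vmul_def eb_def fun_eq_iff)
lemma eb_vadd: "vadd (eb a b j P) (eb a b j Q) = eb a b j (P + Q)"
  by (auto simp: vadd_def eb_def fun_eq_iff)
lemma eb_zero: "eb a b j 0 = v0"
  by (auto simp: v0_def eb_def fun_eq_iff)

lemma eb_evA: "act (evA Q) (eb 0 0 0 P) = eb 0 0 0 (Q * P)"
proof (induction Q rule: poly_mapping_add_induct)
  case (single k c)
  have pow: "(act c1A ^^ n) (eb 0 0 0 P) = eb 0 0 0 (Cp ^ n * P)" for n
    by (induction n) (simp_all add: eb_C1 mult.assoc)
  obtain i m where "k = (i, m)" by force
  then show ?case
    by (simp add: evA_single act_mult act_sA act_pow pow eb_kpow vsc_vmul eb_vmul)
       (simp add: single_lp mult.assoc)
qed (simp_all add: act_zero eb_zero evA_add act_add eb_vadd distrib_right)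

text \<open>The orbit map x to x v; it will identify M(\<eta>) with its image.\<close>

definition phi :: "free_alg \<Rightarrow> vec" where "phi x = act x (eb 0 0 0 1)"

lemma eb_F2_pow: "act (gn F2 ^ n) (eb a b j P) = eb (a + int n) b j P"
proof -
  have "(op F2 ^^ n) (eb a b j P) = eb (a + int n) b j P"
    by (induction n) (simp_all add: eb_F2 algebra_simps)
  then show ?thesis by (simp add: act_pow act_gn[abs_def])
qed

lemma eb_F3_pow: "act (f3A ^ n) (eb 0 b j P) = eb 0 (b + int n) j P"
proof -
  have "(opF3 ^^ n) (eb 0 b j P) = eb 0 (b + int n) j P"
    by (induction n) (simp_all add: eb_F3 algebra_simps)
  then show ?thesis by (simp add: act_pow act_f3[abs_def])
qed

text \<open>Distinct ordered monomials occupy distinct coordinates: this is their linear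
  independence over the coefficient ring.\<close>

lemma phi_mon: "phi (mon a b j * evA P) = eb (int a) (int b) j P"
  by (simp add: phi_def mon_def act_mult eb_evA eb_k2pow eb_F2_pow eb_F3_pow)

lemma phi_add: "phi (x + y) a b j = phi x a b j + phi y a b j"
  by (simp add: phi_def act_add vadd_def)
lemma phi_diff: "phi (x - y) a b j = phi x a b j - phi y a b j"
  by (simp add: phi_def act_diff)
lemma phi_zero: "phi 0 a b j = 0"
  by (simp add: phi_def act_zero v0_def)
lemma phi_mult: "phi (x * y) = act x (phi y)"
  by (simp add: phi_def act_mult)

definition nf :: "(nat \<times> nat \<times> int \<Rightarrow>\<^sub>0 lp) \<Rightarrow> free_alg" where
  "nf Q = pm_lift (\<lambda>(a, b, j) P. mon a b j * evA P) Q"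

lemma nf_add: "nf (P + Q) = nf P + nf Q"
  unfolding nf_def by (rule pm_lift_add) (auto simp: evA_add algebra_simps)
lemma nf_single: "nf (Poly_Mapping.single (a, b, j) P) = mon a b j * evA P"
  unfolding nf_def by (subst pm_lift_single) auto

lemma phi_nf: "phi (nf Q) a b j = (if 0 \<le> a \<and> 0 \<le> b then Poly_Mapping.lookup Q (nat a, nat b, j) else 0)"
proof (induction Q rule: poly_mapping_add_induct)
  case zero
  then show ?case by (simp add: nf_def phi_zero)
next
  case (single k P)
  obtain a' b' j' where "k = (a', b', j')" by (cases k) auto
  then show ?case
    by (auto simp: nf_single phi_mon eb_def lookup_single when_def)
next
  case (add P Q)
  then show ?case by (auto simp: nf_add phi_add lookup_add)
qed

section \<open>The defining left ideals\<close>

text \<open>Every generator acts by finitely many index shifts with coefficients in the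
  ring.\<close>

lemma op_ideal: 
  assumes "is_ideal I" "\<And>a b j. f a b j \<in> I"
  shows "op x f a b j \<in> I"
  by (cases x) (auto simp: op.simps intro!: ideal_intros assms)

lemma whit_sub_phi:
  assumes "w \<in> whit_sub q \<alpha> I" "is_ideal I"
  shows "\<exists>x. w = fa_of x \<and> (\<forall>a b j. phi x a b j \<in> I)"
  using assms
proof induction
  case (ideal a)
  then show ?case
    using uq_ideal_act_zero[of a] by (auto simp: phi_def v0_def intro: ideal_zero)
next
  case e1
  have "phi (gn E1 - sA \<alpha> * 1) a b j = 0" for a b j
    by (simp add: phi_def act_diff act_gn act_sA eb_E1 vsc_vmul eb_vmul)
  then show ?case
    using e1 by (intro exI[of _ "gn E1 - sA \<alpha> * 1"]) (auto simp: to_fa intro: ideal_zero)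
next
  case e2
  have "phi (gn E2) a b j = 0" for a b j
    by (simp add: phi_def act_gn eb_E2 v0_def)
  then show ?case
    using e2 by (intro exI[of _ "gn E2"]) (auto simp: to_fa intro: ideal_zero)
next
  case (idl Q)
  have "phi (evA Q) = eb 0 0 0 Q"
    by (simp add: phi_def eb_evA)
  then show ?case
    using idl by (intro exI[of _ "evA Q"]) (auto simp: fa_of_ev eb_def intro: ideal_zero)
next
  case zero
  then show ?case by (intro exI[of _ 0]) (auto simp: to_fa phi_zero intro: ideal_zero)
next
  case (add v w)
  then obtain x y where "v = fa_of x" "w = fa_of y" "\<forall>a b j. phi x a b j \<in> I" "\<forall>a b j. phi y a b j \<in> I"
    by auto
  then show ?case
    using add by (intro exI[of _ "x + y"]) (auto simp: to_fa phi_add intro: ideal_add)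
next
  case (smul v c)
  then obtain x where "v = fa_of x" "\<forall>a b j. phi x a b j \<in> I" by auto
  then show ?case
    using smul by (intro exI[of _ "sA c * x"]) (auto simp: to_fa phi_mult act_sA vsc_def intro: ideal_mult)
next
  case (lmul v g)
  then obtain x where "v = fa_of x" "\<forall>a b j. phi x a b j \<in> I" by auto
  then show ?case
    using lmul by (intro exI[of _ "gn g * x"]) (auto simp: to_fa phi_mult act_gn intro: op_ideal)
qed

definition Nset :: "lp set \<Rightarrow> free_alg set" where "Nset I = {x. fa_of x \<in> whit_sub q \<alpha> I}"
definition Jset :: "free_alg set" where "Jset = {x. fa_of x \<in> uq_ideal q}"

lemma Nset_phi: "x \<in> Nset I \<Longrightarrow> is_ideal I \<Longrightarrow> phi x a b j \<in> I"
  using whit_sub_phi[of "fa_of x" I] by (auto simp: Nset_def lookup_inject)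

lemma Nset_mono_empty: "x \<in> Nset {} \<Longrightarrow> x \<in> Nset I"
proof -
  have "w \<in> whit_sub q \<alpha> I" if "w \<in> whit_sub q \<alpha> {}" for w
    using that by induction (auto intro: whit_sub.intros)
  then show "x \<in> Nset {} \<Longrightarrow> x \<in> Nset I" by (simp add: Nset_def)
qed

lemma Nset_zero: "0 \<in> Nset I"
  by (simp add: Nset_def whit_sub.zero flip: fa_of_zero)
lemma Nset_add: "x \<in> Nset I \<Longrightarrow> y \<in> Nset I \<Longrightarrow> x + y \<in> Nset I"
  by (simp add: Nset_def whit_sub.add flip: fa_of_add)
lemma Nset_scale: "x \<in> Nset I \<Longrightarrow> sA c * x \<in> Nset I"
  by (simp add: Nset_def whit_sub.smul flip: fa_of_smul)
lemma Jset_zero: "0 \<in> Jset"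
  by (simp add: Jset_def uq_ideal.zero flip: fa_of_zero)
lemma Jset_add: "x \<in> Jset \<Longrightarrow> y \<in> Jset \<Longrightarrow> x + y \<in> Jset"
  by (simp add: Jset_def uq_ideal.add flip: fa_of_add)
lemma Jset_scale: "x \<in> Jset \<Longrightarrow> sA c * x \<in> Jset"
  by (simp add: Jset_def uq_ideal.smul flip: fa_of_smul)

lemma single_Cons: "Poly_Mapping.single (x # w) c = gn x * Poly_Mapping.single w c"
  by (simp add: mult_single_list)

lemma Nset_mult: "x \<in> Nset I \<Longrightarrow> y * x \<in> Nset I"
proof (induction y rule: poly_mapping_add_induct)
  case (single w c)
  then show ?case
  proof (induction w)
    case (Cons g w)
    then have "fa_mul (fa_mon [g]) (fa_of (Poly_Mapping.single w c * x)) \<in> whit_sub q \<alpha> I"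
      by (auto simp: Nset_def intro: whit_sub.lmul)
    then show ?case by (simp add: Nset_def single_Cons[of g w] to_fa mult.assoc)
  qed (simp add: Nset_scale)
qed (auto simp: distrib_right intro: Nset_zero Nset_add)

lemma Jset_mult_left: "x \<in> Jset \<Longrightarrow> y * x \<in> Jset"
proof (induction y rule: poly_mapping_add_induct)
  case (single w c)
  then show ?case
  proof (induction w)
    case (Cons g w)
    then have "fa_mul (fa_mon [g]) (fa_of (Poly_Mapping.single w c * x)) \<in> uq_ideal q"
      by (auto simp: Jset_def intro: uq_ideal.lmul)
    then show ?case by (simp add: Jset_def single_Cons[of g w] to_fa mult.assoc)
  qed (simp add: Jset_scale)
qed (auto simp: distrib_right intro: Jset_zero Jset_add)

lemma Jset_mult_right: "x \<in> Jset \<Longrightarrow> x * y \<in> Jset"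
proof (induction y rule: poly_mapping_add_induct)
  case (single w c)
  then show ?case
  proof (induction w arbitrary: x)
    case Nil
    then show ?case by (simp add: sA_central Jset_scale)
  next
    case (Cons g w)
    have "fa_mul (fa_of x) (fa_mon [g]) \<in> uq_ideal q"
      using Cons.prems by (auto simp: Jset_def intro: uq_ideal.rmul)
    then have "x * gn g \<in> Jset" by (simp add: Jset_def to_fa)
    from Cons.IH[OF this] show ?case by (simp add: single_Cons[of g w] mult.assoc)
  qed
qed (auto simp: distrib_left intro: Jset_zero Jset_add)

lemma Jset_diff: "x \<in> Jset \<Longrightarrow> y \<in> Jset \<Longrightarrow> x - y \<in> Jset"
  using Jset_add[of x "- 1 * y"] Jset_mult_left[of y "- 1"] by simp
lemma Jset_Nset: "x \<in> Jset \<Longrightarrow> x \<in> Nset I"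
  by (simp add: Nset_def Jset_def whit_sub.ideal)
lemma Nset_E1: "gn E1 - sA \<alpha> \<in> Nset I"
  using whit_sub.e1[of \<alpha> q I] by (simp add: Nset_def to_fa)
lemma Nset_E2: "gn E2 \<in> Nset I"
  using whit_sub.e2[of q \<alpha> I] by (simp add: Nset_def to_fa)
lemma Nset_ideal: "Q \<in> I \<Longrightarrow> evA Q \<in> Nset I"
  using whit_sub.idl[of Q I q \<alpha>] by (simp add: Nset_def fa_of_ev)


lemma sA_norm:
  "gn x * (sA c * y) = sA c * (gn x * y)" "f3A * (sA c * y) = sA c * (f3A * y)"
  "sA c * (sA d * y) = sA (c * d) * y" "gn x * sA c = sA c * gn x" "f3A * sA c = sA c * f3A"
  by (rule sA_left_commute, rule sA_left_commute, simp only: sA_mult flip: mult.assoc,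
      rule sA_central, rule sA_central)

section \<open>Commutation relations modulo the defining ideal\<close>

definition cg :: "free_alg \<Rightarrow> free_alg \<Rightarrow> bool" (infix "\<approx>" 50) where
  "x \<approx> y \<longleftrightarrow> x - y \<in> Jset"

lemma cg_refl [simp]: "x \<approx> x"
  by (simp add: cg_def Jset_zero)
lemma cg_sym: "x \<approx> y \<Longrightarrow> y \<approx> x"
  using Jset_diff[OF Jset_zero, of "x - y"] by (simp add: cg_def)
lemma cg_trans [trans]: "x \<approx> y \<Longrightarrow> y \<approx> z \<Longrightarrow> x \<approx> z"
  using Jset_add[of "x - y" "y - z"] by (simp add: cg_def)
lemma cg_eq_trans [trans]: "x \<approx> y \<Longrightarrow> y = z \<Longrightarrow> x \<approx> z" "x = y \<Longrightarrow> y \<approx> z \<Longrightarrow> x \<approx> z"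
  by auto

lemma cg_add: "x \<approx> y \<Longrightarrow> x' \<approx> y' \<Longrightarrow> x + x' \<approx> y + y'"
  using Jset_add[of "x - y" "x' - y'"] by (simp add: cg_def algebra_simps)
lemma cg_left: "x \<approx> y \<Longrightarrow> z * x \<approx> z * y"
  using Jset_mult_left[of "x - y" z] by (simp add: cg_def algebra_simps)
lemma cg_right: "x \<approx> y \<Longrightarrow> x * z \<approx> y * z"
  using Jset_mult_right[of "x - y" z] by (simp add: cg_def algebra_simps)
lemma cg_assoc: "x * y \<approx> z \<Longrightarrow> x * (y * w) \<approx> z * w"
  using cg_right[of "x * y" z w] by (simp add: mult.assoc)
lemma cg_mult: "x \<approx> y \<Longrightarrow> x' \<approx> y' \<Longrightarrow> x * x' \<approx> y * y'"
  by (meson cg_left cg_right cg_trans)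

lemma rel_Jset: "fa_lc xs \<in> uq_rels q \<Longrightarrow> lc xs \<in> Jset"
  by (simp add: Jset_def fa_of_lc uq_ideal.rel)

lemma rel_cg:
  assumes "fa_lc xs \<in> uq_rels q" "x - y = lc xs"
  shows "x \<approx> y"
  using assms rel_Jset by (simp add: cg_def)

context
  fixes i j :: nat
  assumes ij: "i \<in> {1, 2}" "j \<in> {1, 2}"
begin

lemma cg_K_inv: "gn (Kg i) * gn (Kig i) \<approx> 1" "gn (Kig i) * gn (Kg i) \<approx> 1"
proof -
  have "fa_lc [(1, [Kg i, Kig i]), (-1, [])] \<in> uq_rels q" "fa_lc [(1, [Kig i, Kg i]), (-1, [])] \<in> uq_rels q"
    using ij(1) unfolding uq_rels_def by blast+
  note rels = this[THEN rel_cg]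
  show "gn (Kg i) * gn (Kig i) \<approx> 1" "gn (Kig i) * gn (Kg i) \<approx> 1"
    by (rule rels, simp add: lc_def mult_single_list single_uminus)+
qed

lemma cg_EF: "gn (Eg i) * gn (Fg j) \<approx>
   gn (Fg j) * gn (Eg i) + sA (if i = j then D else 0) * (gn (Kg i) - gn (Kig i))"
proof -
  have *: "fa_lc [(1, [Eg i, Fg j]), (-1, [Fg j, Eg i]),
              (- (if i = j then 1 else 0) / (q - inverse q), [Kg i]),
              ((if i = j then 1 else 0) / (q - inverse q), [Kig i])] \<in> uq_rels q"
    using ij unfolding uq_rels_def by blast
  show ?thesis
    by (rule rel_cg[OF *]) (simp add: lc_def mult_single_list single_uminus D_def algebra_simps)
qed

lemma cg_KE:
  "gn (Kg i) * gn (Eg j) \<approx> sA (q powi cartan i j) * (gn (Eg j) * gn (Kg i))"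
  "gn (Kig i) * gn (Eg j) \<approx> sA (q powi (- cartan i j)) * (gn (Eg j) * gn (Kig i))"
  "gn (Kg i) * gn (Fg j) \<approx> sA (q powi (- cartan i j)) * (gn (Fg j) * gn (Kg i))"
  "gn (Kig i) * gn (Fg j) \<approx> sA (q powi cartan i j) * (gn (Fg j) * gn (Kig i))"
proof -
  have "fa_lc [(1, [Kg i, Eg j]), (- (q powi cartan i j), [Eg j, Kg i])] \<in> uq_rels q"
    "fa_lc [(1, [Kig i, Eg j]), (- (q powi (- cartan i j)), [Eg j, Kig i])] \<in> uq_rels q"
    "fa_lc [(1, [Kg i, Fg j]), (- (q powi (- cartan i j)), [Fg j, Kg i])] \<in> uq_rels q"
    "fa_lc [(1, [Kig i, Fg j]), (- (q powi cartan i j), [Fg j, Kig i])] \<in> uq_rels q"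
    using ij unfolding uq_rels_def by blast+
  note rels = this[THEN rel_cg]
  show
    "gn (Kg i) * gn (Eg j) \<approx> sA (q powi cartan i j) * (gn (Eg j) * gn (Kg i))"
    "gn (Kig i) * gn (Eg j) \<approx> sA (q powi (- cartan i j)) * (gn (Eg j) * gn (Kig i))"
    "gn (Kg i) * gn (Fg j) \<approx> sA (q powi (- cartan i j)) * (gn (Fg j) * gn (Kg i))"
    "gn (Kig i) * gn (Fg j) \<approx> sA (q powi cartan i j) * (gn (Fg j) * gn (Kig i))"
    by (rule rels, simp add: lc_def mult_single_list single_uminus)+
qed

end

lemma cg_K1_K2: "gn K1 * gn K2 \<approx> gn K2 * gn K1"
proof -
  have "fa_lc [(1, [K1, K2]), (-1, [K2, K1])] \<in> uq_rels q"
    unfolding uq_rels_def by blast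
  then show ?thesis
    by (rule rel_cg) (simp add: lc_def mult_single_list single_uminus)
qed

lemma f3A_eq: "f3A = gn F1 * gn F2 - sA q * (gn F2 * gn F1)"
  by (simp add: f3A_def lc_def mult_single_list single_uminus)

lemma c1A_eq: "c1A = gn F1 * gn E1 + (sA (D * D * q) * gn K1 + sA (D * D * inverse q) * gn K1i)"
  by (simp add: c1A_def lc_def mult_single_list D_def power2_eq_square)

lemma cg_serre_F:
  assumes "(i, j) \<in> {(1,2), (2,1)}"
  shows "lc [(1, [Fg i, Fg i, Fg j]), (- (q + inverse q), [Fg i, Fg j, Fg i]), (1, [Fg j, Fg i, Fg i])] \<in> Jset"
  by (rule rel_Jset) (use assms in \<open>unfold uq_rels_def, blast\<close>)

text \<open>Already in the free algebra, the difference of the two sides is exactly the Serre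
  polynomial; likewise for \<open>cg_F3_F2\<close>.\<close>

lemma cg_F1_F3: "gn F1 * f3A \<approx> sA (inverse q) * (f3A * gn F1)"
proof -
  have "gn F1 * f3A - sA (inverse q) * (f3A * gn F1) =
    lc [(1, [F1, F1, F2]), (- (q + inverse q), [F1, F2, F1]), (1, [F2, F1, F1])]"
    using q0 by (simp add: lc_def f3A_def mult_single_list single_uminus single_diff distrib_left
        distrib_right left_diff_distrib right_diff_distrib)
  then show ?thesis
    using cg_serre_F[of 1 2] by (simp add: cg_def Fg_def)
qed

lemma cg_F3_F2: "f3A * gn F2 \<approx> sA (inverse q) * (gn F2 * f3A)"
proof -
  have "f3A * gn F2 - sA (inverse q) * (gn F2 * f3A) =
    lc [(1, [F2, F2, F1]), (- (q + inverse q), [F2, F1, F2]), (1, [F1, F2, F2])]"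
    using q0 by (simp add: lc_def f3A_def mult_single_list single_uminus single_diff distrib_left
        distrib_right left_diff_distrib right_diff_distrib)
  then show ?thesis
    using cg_serre_F[of 2 1] by (simp add: cg_def Fg_def)
qed

abbreviation tor :: "gen set" where "tor \<equiv> {K1, K1i, K2, K2i}"

lemmas gen_index = Eg_def Fg_def Kg_def Kig_def cartan_def

lemma torus_comm:
  assumes "g \<in> tor" "e \<in> {E1, E2, F1, F2}"
  obtains c where "c \<noteq> 0" "gn g * gn e \<approx> sA c * (gn e * gn g)"
proof -
  have *: "\<exists>c. c \<noteq> 0 \<and> gn g * gn e \<approx> sA c * (gn e * gn g)"
    if "g \<in> {Kg i, Kig i}" "e \<in> {Eg j, Fg j}" "i \<in> {1, 2}" "j \<in> {1, 2}" for i j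
  proof -
    have "q powi n \<noteq> 0" for n using q0 by simp
    with cg_KE[OF that(3,4)] that(1,2) show ?thesis by blast
  qed
  have "\<exists>i\<in>{1, 2}. g \<in> {Kg i, Kig i}" "\<exists>j\<in>{1, 2}. e \<in> {Eg j, Fg j}"
    using assms by (auto simp: gen_index)
  with * that show ?thesis by blast
qed

lemma torus_comm':
  assumes "g \<in> tor" "e \<in> {E1, E2, F1, F2}"
  obtains c where "gn e * gn g \<approx> sA c * (gn g * gn e)"
proof -
  obtain c where c: "c \<noteq> 0" "gn g * gn e \<approx> sA c * (gn e * gn g)"
    by (rule torus_comm[OF assms])
  have "gn e * gn g = sA (inverse c) * (sA c * (gn e * gn g))"
    using c(1) by (simp add: sA_norm)
  also have "\<dots> \<approx> sA (inverse c) * (gn g * gn e)"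
    by (rule cg_left, rule cg_sym, rule c)
  finally show ?thesis using that by blast
qed

lemma torus_F3:
  assumes g: "g \<in> tor"
  obtains c where "gn g * f3A \<approx> sA c * (f3A * gn g)"
proof -
  obtain c where c: "gn g * gn F1 \<approx> sA c * (gn F1 * gn g)"
    by (rule torus_comm[OF g, of F1]) auto
  obtain d where d: "gn g * gn F2 \<approx> sA d * (gn F2 * gn g)"
    by (rule torus_comm[OF g, of F2]) auto
  have 1: "gn g * (gn F1 * gn F2) \<approx> sA (c * d) * (gn F1 * gn F2 * gn g)"
  proof -
    have "gn g * (gn F1 * gn F2) \<approx> sA c * (gn F1 * (gn g * gn F2))"
      using cg_assoc[OF c] by (simp add: mult.assoc)
    also have "\<dots> \<approx> sA c * (gn F1 * (sA d * (gn F2 * gn g)))"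
      by (intro cg_left d)
    finally show ?thesis by (simp add: sA_norm mult.assoc)
  qed
  have 2: "gn g * (gn F2 * gn F1) \<approx> sA (c * d) * (gn F2 * gn F1 * gn g)"
  proof -
    have "gn g * (gn F2 * gn F1) \<approx> sA d * (gn F2 * (gn g * gn F1))"
      using cg_assoc[OF d] by (simp add: mult.assoc)
    also have "\<dots> \<approx> sA d * (gn F2 * (sA c * (gn F1 * gn g)))"
      by (intro cg_left c)
    finally show ?thesis by (simp add: sA_norm mult.assoc mult.commute[of d c])
  qed
  have "gn g * (gn F1 * gn F2) + sA (- q) * (gn g * (gn F2 * gn F1))
      \<approx> sA (c * d) * (gn F1 * gn F2 * gn g) + sA (- q) * (sA (c * d) * (gn F2 * gn F1 * gn g))"
    by (intro cg_add cg_left 1 2)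
  then have "gn g * f3A \<approx> sA (c * d) * (f3A * gn g)"
    by (simp add: f3A_eq single_uminus sA_norm algebra_simps)
  then show ?thesis using that by blast
qed

lemma cg_E1_F3: "gn E1 * f3A \<approx> f3A * gn E1 + gn F2 * gn K1i"
proof -
  define r1 where "r1 = gn E1 * gn F1 - (gn F1 * gn E1 + sA D * (gn K1 - gn K1i))"
  have 1: "r1 \<in> Jset"
    using cg_EF[of 1 1] by (simp add: gen_index cg_def r1_def)
  define r2 where "r2 = gn E1 * gn F2 - gn F2 * gn E1"
  have 2: "r2 \<in> Jset"
    using cg_EF[of 1 2] by (simp add: gen_index cg_def r2_def)
  define r3 where "r3 = gn K1 * gn F2 - sA q * (gn F2 * gn K1)"
  have 3: "r3 \<in> Jset"
    using cg_KE(3)[of 1 2] by (simp add: gen_index cg_def r3_def)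
  define r4 where "r4 = gn K1i * gn F2 - sA (inverse q) * (gn F2 * gn K1i)"
  have 4: "r4 \<in> Jset"
    using cg_KE(4)[of 1 2] by (simp add: gen_index cg_def r4_def)
  have "D * q = D * inverse q + 1"
    using D_X(2) by (simp add: X_q)
  then have D: "Poly_Mapping.single w (D * q) = Poly_Mapping.single w (D * inverse q) + Poly_Mapping.single w 1" for w
    by (simp flip: single_add)
  \<comment> \<open>The commutator of E_1 with F_1 enters on both sides of F_2. After moving K_1 and
    K_1^(-1) to the right, the K_1 terms cancel and D (q - q^(-1)) F_2 K_1^(-1) = F_2 K_1^(-1)
    remains.\<close>
  have "gn E1 * f3A - (f3A * gn E1 + gn F2 * gn K1i) =
     r1 * gn F2
     + gn F1 * r2
     - sA q * (r2 * gn F1)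
     - sA q * (gn F2 * r1)
     + sA D * r3
     - sA D * r4"
    by (simp add: r1_def r2_def r3_def r4_def f3A_eq ring_distribs mult_single_list mult.commute[of q D] D)
  also have "\<dots> \<in> Jset"
    by (simp add: Jset_add Jset_diff Jset_mult_left Jset_mult_right 1 2 3 4)
  finally show ?thesis by (simp add: cg_def)
qed

lemma cg_E2_F3: "gn E2 * f3A \<approx> f3A * gn E2 + sA (- q) * (gn F1 * gn K2)"
proof -
  define r1 where "r1 = gn E2 * gn F2 - (gn F2 * gn E2 + sA D * (gn K2 - gn K2i))"
  have 1: "r1 \<in> Jset"
    using cg_EF[of 2 2] by (simp add: gen_index cg_def r1_def)
  define r2 where "r2 = gn E2 * gn F1 - gn F1 * gn E2"
  have 2: "r2 \<in> Jset"
    using cg_EF[of 2 1] by (simp add: gen_index cg_def r2_def)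
  define r3 where "r3 = gn K2 * gn F1 - sA q * (gn F1 * gn K2)"
  have 3: "r3 \<in> Jset"
    using cg_KE(3)[of 2 1] by (simp add: gen_index cg_def r3_def)
  define r4 where "r4 = gn K2i * gn F1 - sA (inverse q) * (gn F1 * gn K2i)"
  have 4: "r4 \<in> Jset"
    using cg_KE(4)[of 2 1] by (simp add: gen_index cg_def r4_def)
  have "D * (q * q) = D + q"
    using D_X(1) by (simp add: X_q)
  then have D: "Poly_Mapping.single w (D * (q * q)) = Poly_Mapping.single w D + Poly_Mapping.single w q" for w
    by (simp flip: single_add)
  \<comment> \<open>Here the K_2^(-1) terms cancel, and D (1 - q^2) F_1 K_2 = - q F_1 K_2
    remains.\<close>
  have "gn E2 * f3A - (f3A * gn E2 + sA (- q) * (gn F1 * gn K2)) =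
     r2 * gn F2
     + gn F1 * r1
     - sA q * (r1 * gn F1)
     - sA q * (gn F2 * r2)
     - sA (q * D) * r3
     + sA (q * D) * r4"
    using q0 by (simp add: r1_def r2_def r3_def r4_def f3A_eq ring_distribs mult_single_list single_uminus mult.commute[of q D] mult.assoc D)
  also have "\<dots> \<in> Jset"
    by (simp add: Jset_add Jset_diff Jset_mult_left Jset_mult_right 1 2 3 4)
  finally show ?thesis by (simp add: cg_def)
qed


section \<open>Normal forms\<close>

definition cm :: "free_alg \<Rightarrow> free_alg \<Rightarrow> bool" where "cm x y \<longleftrightarrow> x * y \<approx> y * x"

lemma cm_refl [simp]: "cm x x" by (simp add: cm_def)
lemma cm_one [simp]: "cm x 1" by (simp add: cm_def)
lemma cm_sym: "cm x y \<Longrightarrow> cm y x"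
  by (auto simp: cm_def intro: cg_sym)

lemma cm_mult:
  assumes "cm x y" "cm x z"
  shows "cm x (y * z)"
proof -
  have "x * (y * z) \<approx> y * (x * z)"
    using cg_assoc[of x y "y * x" z] assms(1) by (simp add: cm_def mult.assoc)
  also have "\<dots> \<approx> y * (z * x)"
    using assms(2) by (intro cg_left) (simp add: cm_def)
  finally show ?thesis by (simp add: cm_def mult.assoc)
qed

lemma cm_power: "cm x y \<Longrightarrow> cm x (y ^ n)"
  by (induction n) (auto intro: cm_mult)

lemma cm_add: "cm x y \<Longrightarrow> cm x z \<Longrightarrow> cm x (y + z)"
  unfolding cm_def distrib_left distrib_right by (rule cg_add)

lemma cm_scale: "cm x y \<Longrightarrow> cm x (sA c * y)"
  using cg_left[of "x * y" "y * x" "sA c"] by (simp add: cm_def sA_left_commute[of x] mult.assoc)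

lemma cm_inverse:
  assumes "cm x y" "x * x' \<approx> 1" "x' * x \<approx> 1"
  shows "cm x' y"
proof -
  have "x' * y \<approx> x' * (y * (x * x'))"
    using cg_left[OF cg_left[OF cg_sym[OF assms(2)]], of x' y] by simp
  also have "\<dots> \<approx> x' * (x * y * x')"
    using assms(1) unfolding cm_def mult.assoc[symmetric]
    by (metis (no_types) cg_left cg_right cg_sym mult.assoc)
  also have "\<dots> = x' * x * (y * x')" by (simp add: mult.assoc)
  also have "\<dots> \<approx> 1 * (y * x')" by (intro cg_right assms)
  finally show ?thesis by (simp add: cm_def)
qed

lemma torus_inverse:
  "gn K1 * gn K1i \<approx> 1" "gn K1i * gn K1 \<approx> 1" "gn K2 * gn K2i \<approx> 1" "gn K2i * gn K2 \<approx> 1"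
  using cg_K_inv[of 1 1] cg_K_inv[of 2 2] by (simp_all add: gen_index)

text \<open>The relations give only K_1 K_2 = K_2 K_1; commutation of the inverses follows by
  \<open>cm_inverse\<close>.\<close>

lemma cm_torus:
  assumes "g \<in> tor" "h \<in> tor"
  shows "cm (gn g) (gn h)"
proof -
  have *: "cm (gn K1) (gn K2)" using cg_K1_K2 by (simp add: cm_def)
  have inv: "cm x y" if "x * y \<approx> 1" "y * x \<approx> 1" for x y
    using cg_trans[OF that(1) cg_sym[OF that(2)]] by (simp add: cm_def)
  have a: "cm (gn K1i) (gn K2)" using cm_inverse[OF * torus_inverse(1,2)] .
  have b: "cm (gn K2i) (gn K1)" using cm_inverse[OF cm_sym[OF *] torus_inverse(3,4)] .
  have c: "cm (gn K2i) (gn K1i)" using cm_inverse[OF cm_sym[OF a] torus_inverse(3,4)] .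
  have d: "cm (gn K1) (gn K1i)" "cm (gn K2) (gn K2i)" by (intro inv torus_inverse)+
  from assms * a b c d show ?thesis by (auto intro: cm_sym)
qed

lemma cm_torus_C1:
  assumes "g \<in> tor"
  shows "cm (gn g) c1A"
proof -
  \<comment> \<open>F_1 E_1 has weight zero, so the two scalars multiply to 1.\<close>
  have *: "cm x (gn F1 * gn E1)"
    if "x * gn F1 \<approx> sA c * (gn F1 * x)" "x * gn E1 \<approx> sA d * (gn E1 * x)" "c * d = 1" for x c d
  proof -
    have "x * (gn F1 * gn E1) \<approx> sA c * (gn F1 * (x * gn E1))"
      using cg_assoc[OF that(1)] by (simp add: mult.assoc)
    also have "\<dots> \<approx> sA c * (gn F1 * (sA d * (gn E1 * x)))"
      by (intro cg_left that(2))
    finally show ?thesis using that(3) by (simp add: cm_def sA_norm mult.assoc)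
  qed
  have "cm (gn g) (gn F1 * gn E1)"
    using assms cg_KE[of 1 1] cg_KE[of 2 1] q0 by (auto simp: gen_index power_int_minus intro: *)
  then show ?thesis
    unfolding c1A_eq using assms by (intro cm_add cm_scale cm_torus) auto
qed

text \<open>The torus part of the quantum Casimir element compensates the commutator of E_1 with
  F_1; the two identities \<open>D\<close> state this for the coefficients of F_1 K_1 and F_1
  K_1^(-1).\<close>

lemma cm_F1_C1: "cm (gn F1) c1A"
proof -
  have 1: "gn E1 * gn F1 \<approx> gn F1 * gn E1 + (sA D * gn K1 + sA (- D) * gn K1i)"
    using cg_EF[of 1 1] by (simp add: gen_index algebra_simps single_uminus)
  have 2: "gn K1 * gn F1 \<approx> sA (inverse q * inverse q) * (gn F1 * gn K1)"
    using cg_KE(3)[of 1 1] by (simp add: gen_index power_int_minus power2_eq_square)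
  have 3: "gn K1i * gn F1 \<approx> sA (q * q) * (gn F1 * gn K1i)"
    using cg_KE(4)[of 1 1] by (simp add: gen_index power2_eq_square)
  have "D * (q * q) = D + q"
    using D_X(1) by (simp add: X_q)
  then have D: "D + D * D * q * (inverse q * inverse q) = D * D * q"
     "- D + D * D * inverse q * (q * q) = D * D * inverse q"
    using q0 by (simp_all add: field_simps) algebra+
  have "c1A * gn F1 = gn F1 * (gn E1 * gn F1) + (sA (D * D * q) * (gn K1 * gn F1) + sA (D * D * inverse q) * (gn K1i * gn F1))"
    by (simp add: c1A_eq distrib_right mult.assoc)
  also have "\<dots> \<approx> gn F1 * (gn F1 * gn E1 + (sA D * gn K1 + sA (- D) * gn K1i)) +
     (sA (D * D * q) * (sA (inverse q * inverse q) * (gn F1 * gn K1)) + sA (D * D * inverse q) * (sA (q * q) * (gn F1 * gn K1i)))"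
    by (intro cg_add cg_left 1 2 3)
  also have "\<dots> = gn F1 * (gn F1 * gn E1) +
     (sA (D + D * D * q * (inverse q * inverse q)) * (gn F1 * gn K1) + sA (- D + D * D * inverse q * (q * q)) * (gn F1 * gn K1i))"
    by (simp add: distrib_left distrib_right sA_norm single_add single_diff single_uminus algebra_simps)
  also have "\<dots> = gn F1 * c1A"
    unfolding D by (simp add: c1A_eq distrib_left sA_norm)
  finally show ?thesis unfolding cm_def by (rule cg_sym)
qed

text \<open>Integer powers of an element whose inverse y exists only modulo the ideal; one treatment
  for both K_2 and K.\<close>

definition zp :: "free_alg \<Rightarrow> free_alg \<Rightarrow> int \<Rightarrow> free_alg" where
  "zp x y i = (if 0 \<le> i then x ^ nat i else y ^ nat (- i))"

lemma k2pow_zp: "k2pow = zp (gn K2) (gn K2i)" and kpow_zp: "kpow = zp kA kiA"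
  by (auto simp: k2pow_def kpow_def zp_def fun_eq_iff)

lemma zp_step:
  assumes "x * y \<approx> 1"
  shows "x * zp x y i \<approx> zp x y (i + 1)"
proof (cases "0 \<le> i")
  case True
  then show ?thesis by (simp add: zp_def nat_add_distrib)
next
  case False
  then obtain n where n: "i = - int (Suc n)"
    by (metis neg_int_cases not_le gr0_implies_Suc)
  have "x * zp x y i \<approx> 1 * y ^ n"
    using cg_assoc[OF assms] by (simp add: zp_def n nat_add_distrib)
  also have "1 * y ^ n = zp x y (i + 1)"
    by (simp add: zp_def n)
  finally show ?thesis .
qed

lemma zp_step':
  assumes "y * x \<approx> 1"
  shows "y * zp x y i \<approx> zp x y (i - 1)"
proof (cases "0 < i")
  case True
  then obtain n where n: "i = int (Suc n)"
    by (metis gr0_implies_Suc pos_int_cases)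
  have "y * zp x y i \<approx> 1 * x ^ n"
    using cg_assoc[OF assms] by (simp add: zp_def n nat_add_distrib)
  also have "1 * x ^ n = zp x y (i - 1)"
    by (simp add: zp_def n)
  finally show ?thesis .
next
  case False
  then have "zp x y i = y ^ nat (- i)" "nat (- (i - 1)) = Suc (nat (- i))"
    by (auto simp: zp_def)
  with False show ?thesis by (simp add: zp_def)
qed

lemma cm_zp: "cm u x \<Longrightarrow> cm u y \<Longrightarrow> cm u (zp x y i)"
  by (simp add: zp_def cm_power)

lemma kA_eq: "kA = gn K1 * (gn K2 * gn K2)" and kiA_eq: "kiA = gn K1i * (gn K2i * gn K2i)"
  by (simp_all add: kA_def kiA_def mult_single_list)

lemma cm_torus_k:
  assumes "g \<in> tor"
  shows "cm (gn g) kA" "cm (gn g) kiA" "cm (gn g) (k2pow i)" "cm (gn g) (kpow i)"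
  unfolding k2pow_zp kpow_zp kA_eq kiA_eq using assms by (auto intro!: cm_mult cm_torus cm_zp)

lemma kA_inverse: "kA * kiA \<approx> 1" "kiA * kA \<approx> 1"
proof -
  have *: "(gn a * (gn b * gn b)) * (gn a' * (gn b' * gn b')) \<approx> 1"
    if "gn a * gn a' \<approx> 1" "gn b * gn b' \<approx> 1" "{a, a', b, b'} \<subseteq> tor" for a b a' b'
  proof -
    have "cm (gn b * gn b) (gn a')"
      using that(3) by (intro cm_sym[OF cm_mult] cm_torus) auto
    then have "(gn b * gn b) * gn a' \<approx> gn a' * (gn b * gn b)" by (simp add: cm_def)
    then have "gn a * ((gn b * gn b) * gn a' * (gn b' * gn b')) \<approx> gn a * (gn a' * (gn b * gn b) * (gn b' * gn b'))"
      by (intro cg_left cg_right)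
    also have "\<dots> = gn a * gn a' * (gn b * (gn b * gn b' * gn b'))"
      by (simp only: mult.assoc)
    also have "\<dots> \<approx> 1 * (gn b * (1 * gn b'))"
      by (intro cg_mult cg_refl that)
    also have "\<dots> \<approx> 1" using that(2) by simp
    finally show ?thesis by (simp only: mult.assoc)
  qed
  show "kA * kiA \<approx> 1" "kiA * kA \<approx> 1"
    unfolding kA_eq kiA_eq by (intro * torus_inverse; simp)+
qed

text \<open>K_1 = K K_2^(-2), so K and K_2 generate the torus.\<close>

lemma K1_eq: "gn K1 \<approx> gn K2i * (gn K2i * kA)" "gn K1i \<approx> gn K2 * (gn K2 * kiA)"
proof -
  have *: "gn b' * (gn b' * (gn a * (gn b * gn b))) \<approx> gn a"
    if "gn b' * gn b \<approx> 1" "{a, b, b'} \<subseteq> tor" for a b b'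
  proof -
    have "cm (gn a) (gn b * gn b)"
      using that(2) by (intro cm_mult cm_torus) auto
    then have "gn a * (gn b * gn b) \<approx> (gn b * gn b) * gn a" by (simp add: cm_def)
    then have "gn b' * (gn b' * (gn a * (gn b * gn b))) \<approx> gn b' * (gn b' * ((gn b * gn b) * gn a))"
      by (intro cg_left)
    also have "\<dots> = gn b' * ((gn b' * gn b) * (gn b * gn a))" by (simp only: mult.assoc)
    also have "\<dots> \<approx> gn b' * (1 * (gn b * gn a))" by (intro cg_left cg_right that)
    also have "\<dots> = (gn b' * gn b) * gn a" by (simp only: mult.assoc mult_1_left)
    also have "\<dots> \<approx> 1 * gn a" by (intro cg_right that)
    finally show ?thesis by simp
  qed
  show "gn K1 \<approx> gn K2i * (gn K2i * kA)" "gn K1i \<approx> gn K2 * (gn K2 * kiA)"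
    unfolding kA_eq kiA_eq by (rule cg_sym, intro * torus_inverse; simp)+
qed

section \<open>The span of K_2^j K^i C_1^m v\<close>

lemma Nset_cg: "x \<approx> y \<Longrightarrow> y \<in> Nset I \<Longrightarrow> x \<in> Nset I"
  using Nset_add[OF Jset_Nset, of "x - y" y I] by (simp add: cg_def)

inductive_set U0 :: "free_alg set" where
  null: "x \<in> Nset {} \<Longrightarrow> x \<in> U0"
| mon: "k2pow j * evA (Poly_Mapping.single (i, m) c) \<in> U0"
| add: "x \<in> U0 \<Longrightarrow> y \<in> U0 \<Longrightarrow> x + y \<in> U0"

lemma U0_cg: "x \<approx> y \<Longrightarrow> y \<in> U0 \<Longrightarrow> x \<in> U0"
  using U0.add[OF U0.null[OF Jset_Nset], of "x - y" y] by (simp add: cg_def)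

lemma U0_mon: "sA c * (k2pow j * (kpow i * c1A ^ m)) \<in> U0"
  using U0.mon[of j i m c] by (simp add: evA_single sA_left_commute[of "k2pow j"])

lemma U0_closed:
  assumes "x \<in> U0" "\<And>i j m. y * (k2pow j * (kpow i * c1A ^ m)) \<in> U0"
    "\<And>c z. z \<in> U0 \<Longrightarrow> sA c * z \<in> U0"
  shows "y * x \<in> U0"
  using assms(1)
proof induction
  case (mon j i m c)
  have "sA c * (y * (k2pow j * (kpow i * c1A ^ m))) \<in> U0"
    by (intro assms)
  then show ?case
    by (simp add: evA_single sA_left_commute[of "k2pow j"] sA_left_commute[of y])
qed (auto simp: distrib_left intro: U0.intros Nset_mult)

lemma U0_scale: "x \<in> U0 \<Longrightarrow> sA c * x \<in> U0"
proof (induction rule: U0.induct)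
  case (mon j i m d)
  then show ?case
    using U0_mon[of "c * d" j i m]
    by (simp add: evA_single sA_left_commute[of "k2pow j"] sA_norm)
qed (auto simp: distrib_left intro: U0.intros Nset_mult)

lemma U0_diff: "x \<in> U0 \<Longrightarrow> y \<in> U0 \<Longrightarrow> x - y \<in> U0"
  using U0.add[of x "sA (- 1) * y"] U0_scale[of y "- 1"] by (simp add: single_uminus)

lemma U0_mon1: "k2pow j * (kpow i * c1A ^ m) \<in> U0"
  using U0_mon[of 1] by simp

lemma U0_K2: "x \<in> U0 \<Longrightarrow> gn K2 * x \<in> U0"
proof (rule U0_closed)
  fix i j m
  show "gn K2 * (k2pow j * (kpow i * c1A ^ m)) \<in> U0"
    by (rule U0_cg[OF cg_assoc[OF zp_step[OF torus_inverse(3), folded k2pow_zp]] U0_mon1])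
qed (auto intro: U0_scale)

lemma U0_K2i: "x \<in> U0 \<Longrightarrow> gn K2i * x \<in> U0"
proof (rule U0_closed)
  fix i j m
  show "gn K2i * (k2pow j * (kpow i * c1A ^ m)) \<in> U0"
    by (rule U0_cg[OF cg_assoc[OF zp_step'[OF torus_inverse(4), folded k2pow_zp]] U0_mon1])
qed (auto intro: U0_scale)

lemma cm_k2pow:
  "cm kA (k2pow j)" "cm kiA (k2pow j)"
  unfolding k2pow_zp kA_eq kiA_eq
  by (intro cm_zp; intro cm_sym[OF cm_mult] cm_mult cm_torus; simp; fail)+

lemma U0_kA: "x \<in> U0 \<Longrightarrow> kA * x \<in> U0" and U0_kiA: "x \<in> U0 \<Longrightarrow> kiA * x \<in> U0"
proof -
  have 1: "kA * (k2pow j * (kpow i * c1A ^ m)) \<in> U0" for i j m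
  proof -
    have "kA * (k2pow j * (kpow i * c1A ^ m)) \<approx> k2pow j * (kA * kpow i * c1A ^ m)"
      using cg_assoc[OF cm_k2pow(1)[unfolded cm_def]] by (simp add: mult.assoc)
    also have "\<dots> \<approx> k2pow j * (kpow (i + 1) * c1A ^ m)"
      by (intro cg_left cg_right zp_step[OF kA_inverse(1), folded kpow_zp])
    finally show ?thesis by (rule U0_cg) (rule U0_mon1)
  qed
  have 2: "kiA * (k2pow j * (kpow i * c1A ^ m)) \<in> U0" for i j m
  proof -
    have "kiA * (k2pow j * (kpow i * c1A ^ m)) \<approx> k2pow j * (kiA * kpow i * c1A ^ m)"
      using cg_assoc[OF cm_k2pow(2)[unfolded cm_def]] by (simp add: mult.assoc)
    also have "\<dots> \<approx> k2pow j * (kpow (i - 1) * c1A ^ m)"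
      by (intro cg_left cg_right zp_step'[OF kA_inverse(2), folded kpow_zp])
    finally show ?thesis by (rule U0_cg) (rule U0_mon1)
  qed
  show "x \<in> U0 \<Longrightarrow> kA * x \<in> U0" "x \<in> U0 \<Longrightarrow> kiA * x \<in> U0"
    by (rule U0_closed; (rule 1 2 U0_scale)?; assumption)+
qed

lemma U0_torus: "x \<in> U0 \<Longrightarrow> g \<in> tor \<Longrightarrow> gn g * x \<in> U0"
proof -
  assume x: "x \<in> U0" and g: "g \<in> tor"
  have "gn K1 * x \<in> U0"
    using U0_cg[OF cg_right[OF K1_eq(1)]] x by (simp add: mult.assoc U0_K2i U0_kA)
  moreover have "gn K1i * x \<in> U0"
    using U0_cg[OF cg_right[OF K1_eq(2)]] x by (simp add: mult.assoc U0_K2 U0_kiA)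
  ultimately show ?thesis using g x by (auto intro: U0_K2 U0_K2i)
qed

text \<open>F_1 can be carried through such an x to the vector v. The scalar stays existential
  because \<open>U0\<close> absorbs scalars.\<close>

definition qc :: "free_alg \<Rightarrow> bool" where
  "qc x \<longleftrightarrow> (\<exists>c. gn F1 * x \<approx> sA c * (x * gn F1))"

lemma qc_mult: "qc x \<Longrightarrow> qc y \<Longrightarrow> qc (x * y)"
proof -
  assume "qc x" "qc y"
  then obtain c d where c: "gn F1 * x \<approx> sA c * (x * gn F1)" and d: "gn F1 * y \<approx> sA d * (y * gn F1)"
    by (auto simp: qc_def)
  have "gn F1 * (x * y) \<approx> sA c * (x * (gn F1 * y))"
    using cg_assoc[OF c] by (simp add: mult.assoc)
  also have "\<dots> \<approx> sA c * (x * (sA d * (y * gn F1)))"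
    by (intro cg_left d)
  also have "\<dots> = sA (c * d) * (x * y * gn F1)"
    by (simp add: sA_left_commute[of x] sA_norm mult.assoc)
  finally show ?thesis by (auto simp: qc_def)
qed

lemma qc_one: "qc 1"
  unfolding qc_def by (rule exI[of _ 1]) simp

lemma qc_power: "qc x \<Longrightarrow> qc (x ^ n)"
  by (induction n) (auto intro: qc_mult qc_one)

lemma qc_torus: "g \<in> tor \<Longrightarrow> qc (gn g)"
  by (rule torus_comm'[of g F1]) (auto simp: qc_def)

lemma qc_C1: "qc c1A"
  unfolding qc_def by (rule exI[of _ 1]) (use cm_F1_C1 in \<open>simp add: cm_def\<close>)

lemma qc_mon: "qc (k2pow j * (kpow i * c1A ^ m))"
  by (auto simp: k2pow_def kpow_def kA_eq kiA_eq intro!: qc_mult qc_power qc_torus qc_C1)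

lemma U0_F1: "x \<in> U0 \<Longrightarrow> gn F1 * x \<in> U0"
proof (rule U0_closed)
  fix i j m
  define M where "M = k2pow j * (kpow i * c1A ^ m)"
  have M: "M \<in> U0" by (simp add: M_def U0_mon1)
  obtain c where c: "gn F1 * M \<approx> sA c * (M * gn F1)"
    using qc_mon[of j i m] by (auto simp: qc_def M_def)
  have M_C1: "M * c1A \<in> U0"
    using U0_mon1[of j i "Suc m"] by (simp add: M_def mult.assoc flip: power_Suc2)
  have M_torus: "M * gn g \<in> U0" if "g \<in> tor" for g
  proof -
    have "cm (gn g) M"
      unfolding M_def using that by (intro cm_mult cm_torus_k cm_power cm_torus_C1)
    then have "M * gn g \<approx> gn g * M" by (simp add: cm_def cg_sym)
    then show ?thesis by (rule U0_cg) (intro U0_torus M that)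
  qed
  have N: "M * gn F1 * (gn E1 - sA \<alpha>) \<in> U0"
    by (intro U0.null Nset_mult Nset_E1)
  \<comment> \<open>The definition of C_1 solved for F_1 E_1, with E_1 replaced by \<alpha> at the
    right end, where it meets v; the last term is the error, which lies in the left ideal.\<close>
  have "sA \<alpha> * (M * gn F1) = M * c1A - sA (D * D * q) * (M * gn K1) - sA (D * D * inverse q) * (M * gn K1i)
      - M * gn F1 * (gn E1 - sA \<alpha>)"
    by (simp add: c1A_eq algebra_simps sA_left_commute[of M] sA_central[of "gn F1"] sA_norm)
  also have "\<dots> \<in> U0"
    by (intro U0_diff U0_scale N M_C1 M_torus) auto
  finally have "sA \<alpha>i * (sA \<alpha> * (M * gn F1)) \<in> U0" by (rule U0_scale)
  then have "M * gn F1 \<in> U0"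
    using alpha0 by (simp add: sA_norm \<alpha>i_def)
  then have "gn F1 * M \<in> U0"
    using U0_cg[OF c] by (simp add: U0_scale)
  then show "gn F1 * (k2pow j * (kpow i * c1A ^ m)) \<in> U0" by (simp add: M_def)
qed (auto intro: U0_scale)


text \<open>Modulo the left ideal of \<open>M(\<eta>)\<close>, the sets below are
  \<open>U(F\<^sub>1, K\<^sub>1, K\<^sub>2) v\<close>, \<open>\<Sum> F\<^sub>3\<^sup>b S0\<close> and \<open>\<Sum> F\<^sub>2\<^sup>a S1\<close>; the last one absorbs all generators.\<close>

inductive_set S0 :: "free_alg set" where
  null: "x \<in> Nset {} \<Longrightarrow> x \<in> S0"
| one: "1 \<in> S0"
| torus: "x \<in> S0 \<Longrightarrow> g \<in> tor \<Longrightarrow> gn g * x \<in> S0"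
| F1: "x \<in> S0 \<Longrightarrow> gn F1 * x \<in> S0"
| add: "x \<in> S0 \<Longrightarrow> y \<in> S0 \<Longrightarrow> x + y \<in> S0"
| scale: "x \<in> S0 \<Longrightarrow> sA c * x \<in> S0"

inductive_set S1 :: "free_alg set" where
  base: "x \<in> S0 \<Longrightarrow> x \<in> S1"
| F3: "x \<in> S1 \<Longrightarrow> f3A * x \<in> S1"
| add: "x \<in> S1 \<Longrightarrow> y \<in> S1 \<Longrightarrow> x + y \<in> S1"

inductive_set S2 :: "free_alg set" where
  base: "x \<in> S1 \<Longrightarrow> x \<in> S2"
| F2: "x \<in> S2 \<Longrightarrow> gn F2 * x \<in> S2"
| add: "x \<in> S2 \<Longrightarrow> y \<in> S2 \<Longrightarrow> x + y \<in> S2"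

lemma Jset_S0: "x \<in> Jset \<Longrightarrow> x \<in> S0"
  by (intro S0.null Jset_Nset)

lemma S_cg:
  "x \<approx> y \<Longrightarrow> y \<in> S0 \<Longrightarrow> x \<in> S0" "x \<approx> y \<Longrightarrow> y \<in> S1 \<Longrightarrow> x \<in> S1" "x \<approx> y \<Longrightarrow> y \<in> S2 \<Longrightarrow> x \<in> S2"
  using S0.add[OF Jset_S0, of "x - y" y] S1.add[OF S1.base[OF Jset_S0], of "x - y" y]
    S2.add[OF S2.base[OF S1.base[OF Jset_S0]], of "x - y" y]
  by (simp_all add: cg_def)

lemma S1_scale: "x \<in> S1 \<Longrightarrow> sA c * x \<in> S1"
  by (induction rule: S1.induct)
     (auto simp: distrib_left sA_left_commute[symmetric] intro: S1.intros S0.scale)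

lemma S2_scale: "x \<in> S2 \<Longrightarrow> sA c * x \<in> S2"
  by (induction rule: S2.induct)
     (auto simp: distrib_left sA_left_commute[symmetric] intro: S2.intros S1_scale)

lemma S1_torus: "x \<in> S1 \<Longrightarrow> g \<in> tor \<Longrightarrow> gn g * x \<in> S1"
proof (induction rule: S1.induct)
  case (F3 x)
  obtain c where c: "gn g * f3A \<approx> sA c * (f3A * gn g)"
    by (rule torus_F3[OF \<open>g \<in> tor\<close>])
  show ?case
    by (rule S_cg(2)[OF cg_assoc[OF c]]) (unfold mult.assoc, intro S1_scale S1.F3 F3)
qed (auto simp: distrib_left intro: S1.intros S0.torus)

lemma S2_torus: "x \<in> S2 \<Longrightarrow> g \<in> tor \<Longrightarrow> gn g * x \<in> S2"
proof (induction rule: S2.induct)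
  case (F2 x)
  obtain c where c: "gn g * gn F2 \<approx> sA c * (gn F2 * gn g)"
    by (rule torus_comm[OF \<open>g \<in> tor\<close>, of F2]) auto
  show ?case
    by (rule S_cg(3)[OF cg_assoc[OF c]]) (unfold mult.assoc, intro S2_scale S2.F2 F2)
qed (auto simp: distrib_left intro: S2.intros S1_torus)

lemma S2_F3: "x \<in> S2 \<Longrightarrow> f3A * x \<in> S2"
proof (induction rule: S2.induct)
  case (F2 x)
  show ?case
    by (rule S_cg(3)[OF cg_assoc[OF cg_F3_F2]]) (simp add: mult.assoc S2_scale S2.F2 F2)
qed (auto simp: distrib_left intro: S2.intros S1.F3)

lemma S1_F1: "x \<in> S1 \<Longrightarrow> gn F1 * x \<in> S1"
proof (induction rule: S1.induct)
  case (F3 x)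
  show ?case
    by (rule S_cg(2)[OF cg_assoc[OF cg_F1_F3]]) (simp add: mult.assoc S1_scale S1.F3 F3)
qed (auto simp: distrib_left intro: S1.intros S0.F1)

lemma S2_F1: "x \<in> S2 \<Longrightarrow> gn F1 * x \<in> S2"
proof (induction rule: S2.induct)
  case (F2 x)
  have "gn F1 * (gn F2 * x) = f3A * x + sA q * (gn F2 * (gn F1 * x))"
    by (simp add: f3A_eq algebra_simps)
  then show ?case
    by (simp only:) (intro S2.add S2_F3 S2_scale S2.F2 F2)
qed (auto simp: distrib_left intro: S2.intros S1_F1)

lemma S0_E1: "x \<in> S0 \<Longrightarrow> gn E1 * x \<in> S0"
proof (induction rule: S0.induct)
  case one
  have "gn E1 * 1 = (gn E1 - sA \<alpha>) + sA \<alpha> * 1" by simp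
  then show ?case
    by (simp only:) (intro S0.add S0.scale S0.one S0.null Nset_E1)
next
  case (torus x g)
  obtain c where c: "gn E1 * gn g \<approx> sA c * (gn g * gn E1)"
    by (rule torus_comm'[OF \<open>g \<in> tor\<close>, of E1]) auto
  show ?case
    by (rule S_cg(1)[OF cg_assoc[OF c]]) (unfold mult.assoc, intro S0.scale S0.torus torus)
next
  case (F1 x)
  have "gn E1 * gn F1 \<approx> gn F1 * gn E1 + (sA D * gn K1 + sA (- D) * gn K1i)"
    using cg_EF[of 1 1] by (simp add: gen_index algebra_simps single_uminus)
  from cg_assoc[OF this, of x] show ?case
    by (rule S_cg(1)) (unfold mult.assoc distrib_right, intro S0.add S0.scale S0.F1 S0.torus F1; simp)
next
  case (scale x c)
  then show ?case by (simp add: sA_norm S0.scale)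
qed (auto simp: distrib_left intro: S0.null S0.add Nset_mult)

text \<open>E_2 passes F_1 and, up to scalars, the torus, until it reaches v and kills it.\<close>

lemma S0_E2: "x \<in> S0 \<Longrightarrow> gn E2 * x \<in> Nset {}"
proof (induction rule: S0.induct)
  case (torus x g)
  obtain c where c: "gn E2 * gn g \<approx> sA c * (gn g * gn E2)"
    by (rule torus_comm'[OF \<open>g \<in> tor\<close>, of E2]) auto
  show ?case
    by (rule Nset_cg[OF cg_assoc[OF c]]) (unfold mult.assoc, intro Nset_mult torus)
next
  case (F1 x)
  have "gn E2 * gn F1 \<approx> gn F1 * gn E2"
    using cg_EF[of 2 1] by (simp add: gen_index)
  from cg_assoc[OF this, of x] show ?case
    by (rule Nset_cg) (unfold mult.assoc, intro Nset_mult F1)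
next
  case (scale x c)
  then show ?case by (simp add: sA_norm Nset_mult)
qed (auto simp: distrib_left intro: Nset_add Nset_mult Nset_E2)

text \<open>The target is \<open>S2\<close>, because moving E_1 past F_3 creates F_2
  K_1^(-1).\<close>

lemma S1_E1: "x \<in> S1 \<Longrightarrow> gn E1 * x \<in> S2"
proof (induction rule: S1.induct)
  case (F3 x)
  show ?case
    by (rule S_cg(3)[OF cg_assoc[OF cg_E1_F3]])
       (unfold mult.assoc distrib_right, intro S2.add S2_F3 S2.F2 S2_torus S2.base F3; simp)
qed (auto simp: distrib_left intro: S2.intros S1.intros S0_E1)

lemma S2_E1: "x \<in> S2 \<Longrightarrow> gn E1 * x \<in> S2"
proof (induction rule: S2.induct)
  case (F2 x)
  have "gn E1 * gn F2 \<approx> gn F2 * gn E1"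
    using cg_EF[of 1 2] by (simp add: gen_index)
  from cg_assoc[OF this, of x] show ?case
    by (rule S_cg(3)) (unfold mult.assoc, intro S2.F2 F2)
qed (auto simp: distrib_left intro: S2.intros S1_E1)

text \<open>Moving E_2 past F_3 creates F_1 K_2 but no F_2, so \<open>S1\<close> is not left; this
  is what lets \<open>S2_E2\<close> go through with F_2 standing leftmost.\<close>

lemma S1_E2: "x \<in> S1 \<Longrightarrow> gn E2 * x \<in> S1"
proof (induction rule: S1.induct)
  case (F3 x)
  show ?case
    by (rule S_cg(2)[OF cg_assoc[OF cg_E2_F3]])
       (unfold mult.assoc distrib_right, intro S1.add S1.F3 S1_scale S1_F1 S1_torus F3; simp)
qed (auto simp: distrib_left intro: S1.intros S0.null S0_E2)

lemma S2_E2: "x \<in> S2 \<Longrightarrow> gn E2 * x \<in> S2"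
proof (induction rule: S2.induct)
  case (F2 x)
  have "gn E2 * gn F2 \<approx> gn F2 * gn E2 + (sA D * gn K2 + sA (- D) * gn K2i)"
    using cg_EF[of 2 2] by (simp add: gen_index algebra_simps single_uminus)
  from cg_assoc[OF this, of x] show ?case
    by (rule S_cg(3)) (unfold mult.assoc distrib_right, intro S2.add S2.F2 S2_scale S2_torus F2; simp)
qed (auto simp: distrib_left intro: S2.intros S1_E2)

text \<open>\<open>S2\<close> contains 1 and is closed under left multiplication by every
  generator.\<close>

lemma S2_all: "x \<in> S2"
proof (induction x rule: poly_mapping_add_induct)
  case (single w c)
  have "Poly_Mapping.single w 1 \<in> S2"
  proof (induction w)
    case Nil
    then show ?case by (auto intro: S2.base S1.base S0.one)
  next
    case (Cons g w)
    then have "gn g * Poly_Mapping.single w 1 \<in> S2"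
      by (cases g) (auto intro: S2.F2 S2_F1 S2_E1 S2_E2 S2_torus)
    then show ?case by (simp only: single_Cons[of g w])
  qed
  from S2_scale[OF this, of c] show ?case
    by (simp add: mult_single_list)
qed (auto intro: S2.intros S1.intros S0.intros Nset_zero)

section \<open>Existence of normal forms and the membership criterion\<close>

definition Tset :: "free_alg set" where "Tset = {x. \<exists>Q. x - nf Q \<in> Nset {}}"

lemma Tset_null: "x \<in> Nset {} \<Longrightarrow> x \<in> Tset"
  unfolding Tset_def by (auto intro!: exI[of _ 0] simp: nf_def)

lemma Tset_add: "x \<in> Tset \<Longrightarrow> y \<in> Tset \<Longrightarrow> x + y \<in> Tset"
proof -
  assume "x \<in> Tset" "y \<in> Tset"
  then obtain P Q where "x - nf P \<in> Nset {}" "y - nf Q \<in> Nset {}"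
    by (auto simp: Tset_def)
  from Nset_add[OF this] have "x + y - nf (P + Q) \<in> Nset {}"
    by (simp add: nf_add algebra_simps)
  then show ?thesis by (auto simp: Tset_def)
qed

lemma Tset_U0: "x \<in> U0 \<Longrightarrow> gn F2 ^ a * (f3A ^ b * x) \<in> Tset"
proof (induction rule: U0.induct)
  case (mon j i m c)
  show ?case
    unfolding Tset_def
    by (intro CollectI exI[of _ "Poly_Mapping.single (a, b, j) (Poly_Mapping.single (i, m) c)"])
       (simp add: nf_single mon_def mult.assoc Nset_zero)
qed (auto simp: distrib_left intro: Tset_null Tset_add Nset_mult)

lemma S0_U0: "x \<in> S0 \<Longrightarrow> x \<in> U0"
proof (induction rule: S0.induct)
  case one
  then show ?case using U0.mon[of 0 0 0 1] by (simp add: k2pow_def evA_single kpow_def)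
qed (auto intro: U0.null U0.add U0_torus U0_F1 U0_scale)

text \<open>The exponent b is generalised so that an F_3 produced by \<open>S1\<close> is absorbed
  into the power; \<open>Tset_S2\<close> does the same with a.\<close>

lemma Tset_S1: "x \<in> S1 \<Longrightarrow> gn F2 ^ a * (f3A ^ b * x) \<in> Tset"
proof (induction arbitrary: b rule: S1.induct)
  case (F3 x)
  from F3(2)[of "Suc b"] show ?case by (simp add: power_Suc2 mult.assoc del: power_Suc)
qed (auto simp: distrib_left intro: Tset_U0 S0_U0 Tset_add)

lemma Tset_S2: "x \<in> S2 \<Longrightarrow> gn F2 ^ a * x \<in> Tset"
proof (induction arbitrary: a rule: S2.induct)
  case (base x)
  then show ?case using Tset_S1[of x a 0] by simp
next
  case (F2 x)
  from F2(2)[of "Suc a"] show ?case by (simp add: power_Suc2 mult.assoc del: power_Suc)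
qed (auto simp: distrib_left intro: Tset_add)

lemma normal_form: "\<exists>Q. x - nf Q \<in> Nset {}"
  using Tset_S2[OF S2_all, of 0 x] by (simp add: Tset_def)

lemma phi_normal_form: "x - nf Q \<in> Nset {} \<Longrightarrow> phi x = phi (nf Q)"
  using Nset_phi[OF Nset_mono_empty ideal_singleton_zero, of "x - nf Q"]
  by (auto simp: phi_diff fun_eq_iff)

lemma Nset_sum: "(\<And>k. k \<in> A \<Longrightarrow> f k \<in> Nset I) \<Longrightarrow> sum f A \<in> Nset I"
  by (induction A rule: infinite_finite_induct) (auto intro: Nset_zero Nset_add)

text \<open>The coordinates of x are the coefficients of its normal form. If they all lie in I,
  every summand of the normal form lies in the left ideal, and x differs from it by an element that
  vanishes already in M(\<eta>).\<close>

lemma Nset_iff_phi: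
  assumes I: "is_ideal I"
  shows "x \<in> Nset I \<longleftrightarrow> (\<forall>a b j. phi x a b j \<in> I)"
proof
  assume *: "\<forall>a b j. phi x a b j \<in> I"
  obtain Q where Q: "x - nf Q \<in> Nset {}" using normal_form by blast
  have mem: "Poly_Mapping.lookup Q k \<in> I" for k
  proof -
    obtain a b j where k: "k = (a, b, j)" by (cases k) auto
    have "phi (nf Q) (int a) (int b) j \<in> I"
      using * phi_normal_form[OF Q] by simp
    then show ?thesis by (simp add: phi_nf k)
  qed
  have "nf Q \<in> Nset I"
    unfolding nf_def pm_lift_def
  proof (rule Nset_sum)
    fix k assume "k \<in> Poly_Mapping.keys Q"
    show "(\<lambda>(a, b, j) P. mon a b j * evA P) k (Poly_Mapping.lookup Q k) \<in> Nset I"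
      using mem[of k] by (auto simp: split_beta intro!: Nset_mult Nset_ideal)
  qed
  from Nset_add[OF Nset_mono_empty[OF Q] this] show "x \<in> Nset I" by simp
qed (use Nset_phi I in blast)

text \<open>Bounds the degree a + b, so that only finitely many u(n, l, Q) occur in a Whittaker
  vector.\<close>

lemma phi_support:
  "\<exists>n. \<forall>a b j. phi x a b j \<noteq> 0 \<longrightarrow> 0 \<le> a \<and> 0 \<le> b \<and> a + b \<le> int n"
proof -
  obtain Q where Q: "x - nf Q \<in> Nset {}" using normal_form by blast
  define n where "n = (\<Sum>(a, b, j)\<in>Poly_Mapping.keys Q. a + b)"
  have "0 \<le> a \<and> 0 \<le> b \<and> a + b \<le> int n" if "phi x a b j \<noteq> 0" for a b j
  proof -
    have ab: "0 \<le> a" "0 \<le> b" "(nat a, nat b, j) \<in> Poly_Mapping.keys Q"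
      using that by (auto simp: phi_normal_form[OF Q] phi_nf in_keys_iff split: if_splits)
    have "nat a + nat b \<le> n"
      unfolding n_def using member_le_sum[of "(nat a, nat b, j)" "Poly_Mapping.keys Q" "\<lambda>(a, b, j). a + b"] ab(3)
      by auto
    with ab show ?thesis by auto
  qed
  then show ?thesis by blast
qed


section \<open>Coefficients of the Whittaker vectors\<close>

lemma X_nat: "X (int n) = q ^ n" and X_neg_nat: "X (- int n) = inverse q ^ n"
  by (simp_all add: X_def power_int_minus power_inverse)

lemma X_eq_1: "X n = 1 \<longleftrightarrow> n = 0"
proof
  assume n: "X n = 1"
  have "m = 0" if "X (int m) = 1" for m
    using root[of m] that by (auto simp: X_nat)
  moreover have "X (- n) = 1" using X_inv(1)[of n] n by simp
  ultimately show "n = 0" using n by (cases n rule: int_cases2) auto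
qed simp

lemma X_inject: "X m = X n \<longleftrightarrow> m = n"
  using X_eq_1[of "m - n"] X_add[of "m - n" n] by auto

lemma qn_eq_0: "qn n = 0 \<longleftrightarrow> n = 0"
  by (auto simp: qn_def X_inject)

lemma qint_qn: "qint q n = qn (int n)"
  by (simp add: qint_def qn_def X_nat X_neg_nat D_def)

lemma qfact_Suc: "qfact q (Suc n) = qn (int n + 1) * qfact q n"
  by (simp add: qfact_def qint_qn prod.nat_ivl_Suc' add.commute)

lemma qfact_0 [simp]: "qfact q 0 = 1"
  by (simp add: qfact_def)

lemma qfact_nonzero [simp]: "qfact q n \<noteq> 0"
  by (induction n) (auto simp: qfact_Suc qn_eq_0)

lemma D_sq: "D * (q\<^sup>2 - 1) = X 1"
  using D_eq by (simp add: X_q power2_eq_square)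

text \<open>The exponent of the last power of q in \<open>a_coef\<close>. In the two identities that
  follow, the numerators differ by an even number, so \<open>div\<close> passes through them without
  a parity argument.\<close>

definition ex :: "int \<Rightarrow> int \<Rightarrow> int \<Rightarrow> int" where "ex n k s = (k * (2 * n + 2 * s + k - 7)) div 2"

lemma a_coef_eq:
  assumes "k + s \<le> n"
  shows "a_coef q \<alpha> n k s = (-1) ^ s * \<alpha> ^ k * (q\<^sup>2 - 1) ^ k * X (int s * (int n - 3)) * X (ex (int n) (int k) (int s))
     * (qfact q n / (qfact q k * qfact q s * qfact q (n - k - s)))"
proof -
  have "k \<le> n" "s \<le> n - k" using assms by auto
  then show ?thesis by (simp add: a_coef_def X_def ex_def qbinom_def)
qed

lemma ex_Suc_right: "ex n k (s + 1) = ex n k s + k"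
proof -
  have "k * (2 * n + 2 * (s + 1) + k - 7) = k * (2 * n + 2 * s + k - 7) + k * 2"
    by (simp add: algebra_simps)
  then show ?thesis by (simp only: ex_def)
qed

lemma ex_shift: "ex n (k + 1) s = ex n k (s + 1) + (n + s - 3)"
proof -
  have "(k + 1) * (2 * n + 2 * s + (k + 1) - 7) = k * (2 * n + 2 * (s + 1) + k - 7) + (n + s - 3) * 2"
    by (simp add: algebra_simps)
  then show ?thesis by (simp only: ex_def) simp
qed

text \<open>Extended by zero to all integers, so that the recurrences hold without boundary
  conditions.\<close>

definition cf :: "int \<Rightarrow> int \<Rightarrow> int \<Rightarrow> complex" where
  "cf n k s = (if 0 \<le> k \<and> 0 \<le> s \<and> k + s \<le> n then a_coef q \<alpha> (nat n) (nat k) (nat s) else 0)"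

lemma cf_nat: "cf (int n) (int k) (int s) = (if k + s \<le> n then a_coef q \<alpha> n k s else 0)"
  by (auto simp: cf_def)

lemma cf_0_0: "0 \<le> n \<Longrightarrow> cf n 0 0 = 1"
  by (simp add: cf_def a_coef_eq ex_def)

text \<open>The E_1 equation at K_2^(l+2s), divided by q^l. Passing from (k, s) to (k + 1, s - 1)
  fixes n - k - s, so only [s], [k + 1], a sign, \<alpha> (q^2 - 1) and a power of q change.\<close>

lemma cf_shift: "\<alpha> * (X (2 * s) - 1) * cf n k s = - qn (k + 1) * cf n (k + 1) (s - 1)"
proof (cases "0 \<le> k \<and> 1 \<le> s \<and> k + s \<le> n")
  case True
  define n' k' s' where "n' = nat n" "k' = nat k" "s' = nat (s - 1)"
  with True have eqs: "n = int n'" "k = int k'" "s = int (Suc s')" "k' + Suc s' \<le> n'" by auto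
  define m where "m = n' - k' - Suc s'"
  have m: "n' - Suc k' - s' = m" "n' - Suc (k' + s') = m" by (auto simp: m_def)
  define R where "R = (-1) ^ s' * \<alpha> ^ k' * (q\<^sup>2 - 1) ^ k' * X (int s' * (int n' - 3)) * X (ex n k s) * (qfact q n' / (qfact q k' * qfact q s' * qfact q m))"
  have sp: "s = int s' + 1" by (simp add: eqs)
  have c1: "cf n k s = - (X (n - 3) * R / qn s)"
    using eqs(4) unfolding eqs(1-3) cf_nat
    by (simp add: a_coef_eq m_def[symmetric] R_def qfact_Suc m eqs sp X_add distrib_right add.commute[of "1::int"])
      (simp add: mult_ac)
  have exs: "ex n (k + 1) (s - 1) = ex n k s + (n + s - 4)"
    using ex_shift[of n k "s - 1"] by simp
  have "cf n (k + 1) (s - 1) = cf (int n') (int (Suc k')) (int s')"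
    by (simp add: eqs add.commute)
  also have "\<dots> = a_coef q \<alpha> n' (Suc k') s'"
    using eqs(4) by (subst cf_nat) simp
  also have "\<dots> = \<alpha> * (q\<^sup>2 - 1) * X (n + s - 4) * R / qn (k + 1)"
    using eqs(4) exs
    by (simp add: a_coef_eq R_def qfact_Suc m eqs X_add add.commute[of "1::int"]) (simp add: mult_ac)
  finally have c2: "cf n (k + 1) (s - 1) = \<alpha> * (q\<^sup>2 - 1) * X (n + s - 4) * R / qn (k + 1)" .
  have "(X (2 * s) - 1) * X (n - 3) = (X s - X (- s)) * X (n + s - 3)"
    by (simp add: left_diff_distrib flip: X_add)
  also have "X (n + s - 3) = D * (q\<^sup>2 - 1) * X (n + s - 4)"
    by (simp add: D_sq flip: X_add) 
  finally have E: "(X (2 * s) - 1) * X (n - 3) = qn s * (q\<^sup>2 - 1) * X (n + s - 4)"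
    by (simp add: qn_def)
  have nz: "qn s \<noteq> 0" "qn (k + 1) \<noteq> 0"
    using True by (auto simp: qn_eq_0)
  have "\<alpha> * (X (2 * s) - 1) * cf n k s = - (\<alpha> * R * ((X (2 * s) - 1) * X (n - 3))) / qn s"
    unfolding c1 by simp
  also have "\<dots> = - (\<alpha> * R * ((q\<^sup>2 - 1) * X (n + s - 4)))"
    unfolding E using nz by simp
  also have "\<dots> = - qn (k + 1) * cf n (k + 1) (s - 1)"
    unfolding c2 using nz by simp
  finally show ?thesis .
next
  case False
  \<comment> \<open>Boundary: at k = -1 the factor [0] annihilates the right-hand side, at s = 0 the
    factor q^(2s) - 1 annihilates the left; elsewhere both coefficients vanish.\<close>
  then consider "k = - 1" | "k < - 1" | "s = 0" | "s < 0" | "k + s > n" by linarith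
  then show ?thesis by cases (auto simp: cf_def)
qed

text \<open>Raising s alone multiplies the coefficient by - q^(n+k-3) [n-k-s] / [s+1]; both sides
  are this ratio cleared of denominators.\<close>

lemma cf_step: "(X (2 * s + 2) - 1) * cf n k (s + 1) = - (X (2 * n - 2) - X (2 * k + 2 * s - 2)) * cf n k s"
proof (cases "0 \<le> k \<and> 0 \<le> s \<and> k + s < n")
  case True
  define n' k' s' where "n' = nat n" "k' = nat k" "s' = nat s"
  with True have eqs: "n = int n'" "k = int k'" "s = int s'" "k' + Suc s' \<le> n'" by auto
  define m where "m = n' - k' - Suc s'"
  have m: "n' - (k' + s') = Suc m" "n' - Suc (k' + s') = m" "int m = n - k - s - 1"
    using eqs(4) by (auto simp: m_def eqs)
  define R where "R = (-1) ^ s' * \<alpha> ^ k' * (q\<^sup>2 - 1) ^ k' * X (int s' * (int n' - 3)) * X (ex n k s) * (qfact q n' / (qfact q k' * qfact q s' * qfact q m))"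
  have c1: "cf n k s = R / qn (n - k - s)"
    using eqs(4) m(3) unfolding eqs(1-3) cf_nat
    by (simp add: a_coef_eq R_def qfact_Suc m(1) eqs(1-3))
  have "cf n k (s + 1) = cf (int n') (int k') (int (Suc s'))"
    by (simp add: eqs add.commute)
  also have "\<dots> = a_coef q \<alpha> n' k' (Suc s')"
    using eqs(4) by (subst cf_nat) simp
  also have "\<dots> = - (X (n - 3) * X k * R / qn (s + 1))"
    using eqs(4) ex_Suc_right[of n k s]
    by (simp add: a_coef_eq R_def qfact_Suc m eqs(1-3) X_add distrib_right add.commute[of "1::int"])
       (simp add: mult_ac)
  finally have c2: "cf n k (s + 1) = - (X (n - 3) * X k * R / qn (s + 1))" .
  have nz: "qn (n - k - s) \<noteq> 0" "qn (s + 1) \<noteq> 0" 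
    using True by (auto simp: qn_eq_0)
  have "(X (2 * s + 2) - 1) * D = X (s + 1) * qn (s + 1)"
    by (simp add: qn_def right_diff_distrib left_diff_distrib flip: X_add mult.assoc)
  moreover have "X (s + 1) * X (n - 3) * X k * qn (n - k - s) = (X (2 * n - 2) - X (2 * k + 2 * s - 2)) * D"
    by (simp add: qn_def right_diff_distrib left_diff_distrib flip: X_add mult.assoc) (simp add: algebra_simps)
  ultimately have "(X (2 * s + 2) - 1) * X (n - 3) * X k * qn (n - k - s) * D =
       (X (2 * n - 2) - X (2 * k + 2 * s - 2)) * qn (s + 1) * D"
    by algebra
  then have "(X (2 * s + 2) - 1) * X (n - 3) * X k * qn (n - k - s) =
       (X (2 * n - 2) - X (2 * k + 2 * s - 2)) * qn (s + 1)"
    by simp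
  then show ?thesis
    unfolding c1 c2 using nz by (simp add: divide_simps) algebra
next
  case False
  \<comment> \<open>At s = -1 the left factor vanishes, at k + s = n the right one does; elsewhere
    both coefficients are zero.\<close>
  then consider "k < 0" | "s = - 1" | "s < - 1" | "k + s = n" | "k + s > n" by linarith
  then show ?thesis by cases (auto simp: cf_def)
qed


section \<open>Whittaker vectors\<close>

text \<open>The sum of the vectors \<open>u(n, l, Q\<^sub>n)\<close>, where \<open>F\<^sub>2\<^sup>a F\<^sub>3\<^sup>b\<close> has degree \<open>n = a + b\<close>.\<close>

definition Uv :: "int \<Rightarrow> (nat \<Rightarrow> lp) \<Rightarrow> vec" where
  "Uv l Qs = (\<lambda>a b j. if even (j - l)
     then sc (cf (a + b) b ((j - l) div 2) * X (b * l)) * (Kp (- (j - l) - b) * Qs (nat (a + b))) else 0)"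

lemma Uv_even: "Uv l Qs a b (l + 2 * s) = sc (cf (a + b) b s * X (b * l)) * (Kp (- 2 * s - b) * Qs (nat (a + b)))"
  by (simp add: Uv_def)

lemma Uv_odd: "odd (j - l) \<Longrightarrow> Uv l Qs a b j = 0"
  by (simp add: Uv_def)

lemma Uv_negative: "a < 0 \<or> b < 0 \<Longrightarrow> Uv l Qs a b j = 0"
  by (auto simp: Uv_def cf_def)

text \<open>This is \<open>cf_shift\<close>. It holds exactly and for every family
  \<open>Qs\<close>, so that only E_2 constrains \<open>Qs\<close>.\<close>

lemma Uv_E1: "op E1 (Uv l Qs) a b j = sc (\<alpha> * X l) * Uv l Qs a b j"
proof (cases "even (j - l)")
  case True
  then obtain s where "j - l = 2 * s" by (elim evenE)
  then have s: "j = l + 2 * s" by simp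
  define Q where "Q = Qs (nat (a + b))"
  have 1: "Uv l Qs a b j = sc (cf (a + b) b s * X (b * l)) * (Kp (- 2 * s - b) * Q)"
    by (simp only: s Uv_even Q_def)
  have 2: "Uv l Qs (a - 1) (b + 1) (j - 2) = sc (cf (a + b) (b + 1) (s - 1) * X (b * l + l)) * (Kp (- 2 * s - b + 1) * Q)"
    using Uv_even[of l Qs "a - 1" "b + 1" "s - 1"] by (simp add: s Q_def algebra_simps)
  have key: "\<alpha> * X j * (cf (a + b) b s * X (b * l)) + qn (b + 1) * (cf (a + b) (b + 1) (s - 1) * X (b * l + l))
     = \<alpha> * X l * (cf (a + b) b s * X (b * l))"
    using cf_shift[of s "a + b" b] unfolding s X_add by algebra
  show ?thesis
  proof (rule lp_eqI)
    fix m c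
    have i: "m + 1 - (- 2 * s - b + 1) = m - (- 2 * s - b)" by simp
    show "lk (op E1 (Uv l Qs) a b j) m c = lk (sc (\<alpha> * X l) * Uv l Qs a b j) m c"
      unfolding op.simps 1 2 lk_simps diff_minus_eq_add i using key by algebra
  qed
next
  case False
  then show ?thesis by (simp add: op.simps Uv_odd)
qed

definition hv :: "int \<Rightarrow> lp" where
  "hv n = sc (X (3 - 2 * n)) * Kp 1 + sc (X (2 * n - 3)) * Kp (- 1) - sc ((q - inverse q)\<^sup>2) * Cp"

lemma h_poly_hv: "h_poly q n = hv (int n)"
  by (simp add: h_poly_def hv_def sc_def Kp_def Cp_def mult_single X_def)

text \<open>The scalar common to all three terms of h_n in the E_2 equation at F_2^a F_3^b
  K_2^(l+2s-1), where n = a + b + 1. It vanishes at s = 0.\<close>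

definition uscale :: "int \<Rightarrow> int \<Rightarrow> int \<Rightarrow> int \<Rightarrow> complex" where
  "uscale l n b s = - (D * D * X (b * l) * X (2 - b - 2 * s) * ((X (2 * s) - 1) * cf n b s))"

lemma uscale_nonpositive: "n \<le> 0 \<Longrightarrow> uscale l n b s = 0"
  by (cases "s = 0") (auto simp: uscale_def cf_def)

text \<open>By \<open>cf_step\<close> the scalar is a nonzero multiple of q^(2n-2) - q^(-2). This
  coordinate later yields the condition that h_n Q lies in I.\<close>

lemma uscale_nonzero: "1 \<le> n \<Longrightarrow> uscale l n 0 1 \<noteq> 0"
proof -
  assume n: "1 \<le> n"
  have "(X 2 - 1) * cf n 0 1 = - (X (2 * n - 2) - X (- 2))"
    using cf_step[of 0 n 0] cf_0_0[of n] n by simp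
  moreover have "X (2 * n - 2) \<noteq> X (- 2)" using n by (simp add: X_inject)
  ultimately show ?thesis by (simp add: uscale_def)
qed

text \<open>In order, the C_1, K^(-1) and K terms of h_n; \<open>w\<close> is the prefactor of the
  bracket in \<open>op E2\<close>.\<close>

lemma Uv_E2_scalars:
  fixes l a b s :: int
  defines "n \<equiv> a + b + 1" and "j \<equiv> l + 2 * s - 1"
  defines "w \<equiv> X (1 - b - j) * \<alpha>i * qn (b + 1)"
  shows "w * (cf n (b + 1) (s - 1) * X (b * l + l)) = uscale l n b s * (q - inverse q)\<^sup>2"
    and "w * (D * D * X (- 1)) * (cf n (b + 1) s * X (b * l + l)) - qn (a + 1) * D * X (a + b) * (cf n b s * X (b * l))
      = uscale l n b s * X (2 * n - 3)"
    and "w * (D * D * X 1) * (cf n (b + 1) (s - 2) * X (b * l + l)) + qn (a + 1) * D * X (- a - b) * (cf n b (s - 1) * X (b * l))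
      = uscale l n b s * X (3 - 2 * n)"
proof -
  define r where "r = X (b * l)"
  define v where "v = X (2 - b - 2 * s)"
  have "X (1 - b - j) * X (b * l + l) = X (2 - b - 2 * s + b * l)"
    unfolding X_add[symmetric] by (simp add: j_def algebra_simps)
  then have rv: "X (1 - b - j) * X (b * l + l) = v * r" 
    by (simp only: X_add r_def v_def)
  \<comment> \<open>\<open>cf_shift\<close> at s = t + 1 lowers the first index from b + 1 to b, and
    its \<alpha> cancels \<open>\<alpha>i\<close>; only \<open>cf n b\<close> is left.\<close>
  have wcf: "w * (cf n (b + 1) t * X (b * l + l)) = - (r * v * (X (2 * t + 2) - 1) * cf n b (t + 1))" for t
  proof -
    have "w * (cf n (b + 1) t * X (b * l + l)) = \<alpha>i * (v * r) * (qn (b + 1) * cf n (b + 1) t)"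
      unfolding w_def rv[symmetric] by (simp add: mult_ac)
    also have "qn (b + 1) * cf n (b + 1) t = - (\<alpha> * (X (2 * t + 2) - 1) * cf n b (t + 1))"
      using cf_shift[of "t + 1" n b] by (simp add: algebra_simps)
    finally show ?thesis using alpha0 by (simp add: \<alpha>i_def)
  qed
  have us: "uscale l n b s = - (D * D * r * v * ((X (2 * s) - 1) * cf n b s))"
    by (simp add: uscale_def r_def v_def)
  have D: "D * (q - inverse q) = 1"
    using q0 q_sq by (simp add: D_def field_simps)
  show "w * (cf n (b + 1) (s - 1) * X (b * l + l)) = uscale l n b s * (q - inverse q)\<^sup>2"
    using wcf[of "s - 1"] D unfolding us by (simp add: power2_eq_square) algebra
  have qa: "qn (a + 1) = (X (n - b) - X (b - n)) * D"
    by (simp add: qn_def n_def)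
  have I3: "v * X (- 1) * (X (2 * n - 2) - X (2 * b + 2 * s - 2)) - (X (n - b) - X (b - n)) * X (n - 1)
     = - (v * (X (2 * s) - 1) * X (2 * n - 3))"
    unfolding v_def by (simp add: right_diff_distrib left_diff_distrib flip: X_add) (simp add: algebra_simps)
  have w3: "w * (cf n (b + 1) s * X (b * l + l)) = r * v * (X (2 * n - 2) - X (2 * b + 2 * s - 2)) * cf n b s"
    using wcf[of s] cf_step[of s n b] by algebra
  have ab: "X (a + b) = X (n - 1)" "X (- a - b) = X (1 - n)" by (simp_all add: n_def)
  show "w * (D * D * X (- 1)) * (cf n (b + 1) s * X (b * l + l)) - qn (a + 1) * D * X (a + b) * (cf n b s * X (b * l))
      = uscale l n b s * X (2 * n - 3)"
    using w3 I3 unfolding us qa ab r_def[symmetric] by algebra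
  have I2: "- (v * X 1 * (X (2 * s - 2) - 1)) + (X (n - b) - X (b - n)) * X (1 - n)
     = v * (X (2 * n - 2) - X (2 * b + 2 * s - 4)) * X (3 - 2 * n)"
    unfolding v_def by (simp add: right_diff_distrib left_diff_distrib flip: X_add) (simp add: algebra_simps)
  have w2: "w * (cf n (b + 1) (s - 2) * X (b * l + l)) = - (r * v * (X (2 * s - 2) - 1) * cf n b (s - 1))"
    using wcf[of "s - 2"] by (simp add: algebra_simps)
  have st: "(X (2 * s) - 1) * cf n b s = - (X (2 * n - 2) - X (2 * b + 2 * s - 4)) * cf n b (s - 1)"
    using cf_step[of "s - 1" n b] by (simp add: algebra_simps)
  show "w * (D * D * X 1) * (cf n (b + 1) (s - 2) * X (b * l + l)) + qn (a + 1) * D * X (- a - b) * (cf n b (s - 1) * X (b * l))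
      = uscale l n b s * X (3 - 2 * n)"
    using w2 I2 unfolding us st qa ab r_def[symmetric] by algebra
qed

text \<open>The origin of h_n: each coordinate of E_2 u is a scalar times a power of K times h_n Q,
  so one condition per degree controls all coordinates.\<close>

lemma Uv_E2:
  "op E2 (Uv l Qs) a b (l + 2 * s - 1)
    = sc (uscale l (a + b + 1) b s) * (Kp (1 - 2 * s - b) * (hv (a + b + 1) * Qs (nat (a + b + 1))))"
proof -
  define n where "n = a + b + 1"
  define j where "j = l + 2 * s - 1"
  define Q where "Q = Qs (nat n)"
  note scal = Uv_E2_scalars[of b l s a, folded n_def j_def]
  have u1: "Uv l Qs a (b + 1) (j + 1) = sc (cf n (b + 1) s * X (b * l + l)) * (Kp (- 2 * s - b - 1) * Q)"
    using Uv_even[of l Qs a "b + 1" s] by (simp add: j_def n_def Q_def algebra_simps)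
  have u2: "Uv l Qs a (b + 1) (j - 3) = sc (cf n (b + 1) (s - 2) * X (b * l + l)) * (Kp (3 - 2 * s - b) * Q)"
    using Uv_even[of l Qs a "b + 1" "s - 2"] by (simp add: j_def n_def Q_def algebra_simps)
  have u3: "Uv l Qs a (b + 1) (j - 1) = sc (cf n (b + 1) (s - 1) * X (b * l + l)) * (Kp (1 - 2 * s - b) * Q)"
    using Uv_even[of l Qs a "b + 1" "s - 1"] by (simp add: j_def n_def Q_def algebra_simps)
  have u4: "Uv l Qs (a + 1) b (j - 1) = sc (cf n b (s - 1) * X (b * l)) * (Kp (2 - 2 * s - b) * Q)"
    using Uv_even[of l Qs "a + 1" b "s - 1"] by (simp add: j_def n_def Q_def algebra_simps)
  have u5: "Uv l Qs (a + 1) b (j + 1) = sc (cf n b s * X (b * l)) * (Kp (- 2 * s - b) * Q)"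
    using Uv_even[of l Qs "a + 1" b s] by (simp add: j_def n_def Q_def algebra_simps)
  have "op E2 (Uv l Qs) a b j = sc (uscale l n b s) * (Kp (1 - 2 * s - b) * (hv n * Q))"
  proof (rule lp_eqI)
    fix m c
    define P1 P2 P3 where "P1 = lk Q (m + 2 * s + b) c" "P2 = lk Q (m + 2 * s + b - 2) c"
      "P3 = lk Q (m + 2 * s + b - 1) (c - 1)"
    have i: "lk Q (m - 1 - (- 2 * s - b - 1)) c = P1" "lk Q (m - (- 1) - (3 - 2 * s - b)) c = P2"
      "lk Q (m - (1 - 2 * s - b)) (c - 1) = P3" "lk Q (m - (2 - 2 * s - b)) c = P2"
      "lk Q (m - (- 2 * s - b)) c = P1"
      by (simp_all add: P1_P2_P3_def algebra_simps)
    have h: "lk (hv n * Q) (m - (1 - 2 * s - b)) c = X (3 - 2 * n) * P2 + X (2 * n - 3) * P1 - (q - inverse q)\<^sup>2 * P3"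
      unfolding hv_def distrib_right left_diff_distrib mult.assoc lk_simps
      by (simp add: P1_P2_P3_def algebra_simps)
    show "lk (op E2 (Uv l Qs) a b j) m c = lk (sc (uscale l n b s) * (Kp (1 - 2 * s - b) * (hv n * Q))) m c"
      unfolding op.simps u1 u2 u3 u4 u5 lk_simps i h using scal by algebra
  qed
  then show ?thesis by (simp add: n_def j_def Q_def)
qed

lemma Uv_E2_even: "even (j - l) \<Longrightarrow> op E2 (Uv l Qs) a b j = 0"
  by (simp add: op.simps Uv_odd)


section \<open>The vectors u(n, l, Q) in coordinates\<close>

definition uA :: "nat \<Rightarrow> int \<Rightarrow> lp \<Rightarrow> free_alg" where
  "uA n l Q = sA (q powi (2 * int n * l)) * (k2pow l * (\<Sum>(k, j)\<in>{(k, j). k \<le> n \<and> j \<le> n - k}.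
     sA (a_coef q \<alpha> n k j) * (gn F2 ^ (n - k) * (f3A ^ k * (k2pow (2 * int j) * (kpow (- 2 * int j - int k) * evA Q))))))"

lemma fa_of_u: "u_vec q \<alpha> n l Q = fa_of (uA n l Q)"
  unfolding u_vec_def uA_def fa_of_Kpow fa_of_K2pow fa_of_ev fa_of_F3 case_prod_unfold
  by (simp add: to_fa)

lemma act_sum: "act x (\<lambda>a b j. \<Sum>i\<in>S. f i a b j) = (\<lambda>a b j. \<Sum>i\<in>S. act x (f i) a b j)"
proof (induction S rule: infinite_finite_induct)
  case (insert i S)
  have "(\<lambda>a b j. \<Sum>i\<in>insert i S. f i a b j) = vadd (f i) (\<lambda>a b j. \<Sum>i\<in>S. f i a b j)"
    using insert by (simp add: vadd_def)
  then show ?case using insert by (simp add: act_vadd) (simp add: vadd_def)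
qed (simp_all add: act_of_v0[unfolded v0_def])

lemma phi_sum: "phi (\<Sum>i\<in>S. f i) a b j = (\<Sum>i\<in>S. phi (f i) a b j)"
  by (induction S rule: infinite_finite_induct) (simp_all add: phi_add phi_zero)

lemma phi_uA: "phi (uA n l Q) = Uv l (\<lambda>m. if m = n then Q else 0)"
proof (intro ext)
  fix a b j
  define S where "S = {(k, s). k \<le> n \<and> s \<le> n - k}"
  define T where "T = (\<lambda>(k, s). sA (a_coef q \<alpha> n k s) * (gn F2 ^ (n - k) * (f3A ^ k * (k2pow (2 * int s) * (kpow (- 2 * int s - int k) * evA Q)))))"
  have fin: "finite S"
    by (rule finite_subset[of _ "{..n} \<times> {..n}"]) (auto simp: S_def)
  have T: "phi (T (k, s)) = eb (int (n - k)) (int k) (2 * int s) (sc (a_coef q \<alpha> n k s) * (Kp (- 2 * int s - int k) * Q))" for k s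
    by (simp add: T_def phi_def act_mult eb_evA eb_kpow eb_k2pow eb_F3_pow eb_F2_pow act_sA vsc_vmul eb_vmul)
  define P where "P = (\<lambda>(k, s). sc (q powi (2 * int n * l)) * (sc (X (l * (- 2 * int (n - k) - int k))) * (sc (a_coef q \<alpha> n k s) * (Kp (- 2 * int s - int k) * Q))))"
  have "phi (uA n l Q) = vsc (q powi (2 * int n * l)) (act (k2pow l) (phi (\<Sum>i\<in>S. T i)))"
    by (simp add: uA_def phi_mult act_sA S_def T_def)
  also have "phi (\<Sum>i\<in>S. T i) = (\<lambda>a b j. \<Sum>i\<in>S. phi (T i) a b j)"
    by (intro ext phi_sum)
  finally have "phi (uA n l Q) a b j = (\<Sum>i\<in>S. sc (q powi (2 * int n * l)) * act (k2pow l) (phi (T i)) a b j)"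
    by (simp add: act_sum vsc_def sum_distrib_left)
  also have "\<dots> = (\<Sum>i\<in>S. if a = int (n - fst i) \<and> b = int (fst i) \<and> j = l + 2 * int (snd i) then P i else 0)"
  proof (rule sum.cong)
    fix i :: "nat \<times> nat"
    obtain k s where i: "i = (k, s)" by force
    show "sc (q powi (2 * int n * l)) * act (k2pow l) (phi (T i)) a b j =
      (if a = int (n - fst i) \<and> b = int (fst i) \<and> j = l + 2 * int (snd i) then P i else 0)"
      unfolding i T eb_k2pow P_def by (simp add: eb_def add.commute)
  qed simp
  also have "\<dots> = Uv l (\<lambda>m. if m = n then Q else 0) a b j"
  \<comment> \<open>Each coordinate receives at most one summand, since (a, b, j) determines k = b
    and s.\<close>
  proof (cases "\<exists>k s. (k, s) \<in> S \<and> a = int (n - k) \<and> b = int k \<and> j = l + 2 * int s")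
    case True
    then obtain k s where ks: "(k, s) \<in> S" "a = int (n - k)" "b = int k" "j = l + 2 * int s" by blast
    have "(\<Sum>i\<in>S. if a = int (n - fst i) \<and> b = int (fst i) \<and> j = l + 2 * int (snd i) then P i else 0)
      = (\<Sum>i\<in>S. if i = (k, s) then P i else 0)"
      by (rule sum.cong) (use ks in auto)
    also have "\<dots> = P (k, s)" using fin ks by simp
    also have "\<dots> = Uv l (\<lambda>m. if m = n then Q else 0) a b j"
    proof -
      have kn: "k \<le> n" "k + s \<le> n" using ks(1) by (auto simp: S_def)
      \<comment> \<open>Passing F_2^(n-k) F_3^k, the factor K_2^l picks up q^(-l(2(n-k)+k)); the
        normalising q^(2nl) leaves q^(kl), the \<open>X (b * l)\<close> of
        \<open>Uv\<close>.\<close>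
      have "2 * int n * l + l * (- 2 * int (n - k) - int k) = int k * l"
        using kn by (simp add: algebra_simps of_nat_diff)
      then have "q powi (2 * int n * l) * X (l * (- 2 * int (n - k) - int k)) = X (int k * l)"
        unfolding X_def[symmetric, of "2 * int n * l"] by (simp flip: X_add)
      moreover have "P (k, s) = sc (a_coef q \<alpha> n k s * (q powi (2 * int n * l) * X (l * (- 2 * int (n - k) - int k))))
          * (Kp (- 2 * int s - int k) * Q)"
        unfolding P_def prod.case by (simp only: mult.assoc[symmetric] sc_mult) (simp only: mult_ac)
      moreover have "int (n - k) + int k = int n" using kn by simp
      ultimately show ?thesis
        using kn unfolding ks(2-4) Uv_even by (simp add: cf_nat)
    qed
    finally show ?thesis .
  next
    case False
    have "Uv l (\<lambda>m. if m = n then Q else 0) a b j = 0"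
    proof (rule ccontr)
      assume nz: "Uv l (\<lambda>m. if m = n then Q else 0) a b j \<noteq> 0"
      then have ev: "even (j - l)" and n: "nat (a + b) = n" and cf: "cf (a + b) b ((j - l) div 2) \<noteq> 0"
        by (auto simp: Uv_def split: if_splits)
      define s where "s = (j - l) div 2"
      have s: "0 \<le> b" "0 \<le> s" "b + s \<le> a + b" using cf by (auto simp: cf_def s_def split: if_splits)
      have "j = l + 2 * s" using ev by (simp add: s_def)
      then have "(nat b, nat s) \<in> S \<and> a = int (n - nat b) \<and> b = int (nat b) \<and> j = l + 2 * int (nat s)"
        using s n by (auto simp: S_def)
      with False show False by blast
    qed
    moreover have "(\<Sum>i\<in>S. if a = int (n - fst i) \<and> b = int (fst i) \<and> j = l + 2 * int (snd i) then P i else 0) = 0"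
      using False by (intro sum.neutral) auto
    ultimately show ?thesis by simp
  qed
  finally show "phi (uA n l Q) a b j = Uv l (\<lambda>m. if m = n then Q else 0) a b j" .
qed

text \<open>Makes K_2^l Q v the degree-zero case of u(n, l, Q), so both families of generators are
  treated together.\<close>

lemma uA_0: "uA 0 l Q = k2pow l * evA Q"
proof -
  have "{(k, j). k \<le> (0::nat) \<and> j \<le> 0 - k} = {(0, 0 :: nat)}" by auto
  then show ?thesis
    using cf_0_0[of 0] by (simp add: uA_def cf_def k2pow_def kpow_def)
qed

section \<open>The Whittaker equations modulo an ideal\<close>

definition whit_vec :: "lp set \<Rightarrow> int \<Rightarrow> vec \<Rightarrow> bool" where
  "whit_vec I l f \<longleftrightarrow> (\<forall>a b j. op E1 f a b j - sc (\<alpha> * X l) * f a b j \<in> I \<and> op E2 f a b j \<in> I)"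

lemma is_whittaker_iff:
  assumes "is_ideal I"
  shows "is_whittaker (whit_sub q \<alpha> I) (\<alpha> * q powi l) (fa_of x) \<longleftrightarrow> whit_vec I l (phi x)"
proof -
  have "is_whittaker (whit_sub q \<alpha> I) (\<alpha> * q powi l) (fa_of x) \<longleftrightarrow>
    gn E1 * x - sA (\<alpha> * X l) * x \<in> Nset I \<and> gn E2 * x \<in> Nset I"
    by (simp add: is_whittaker_def to_fa Nset_def X_def)
  then show ?thesis
    by (auto simp: Nset_iff_phi[OF assms] phi_diff phi_mult act_gn act_sA vsc_def whit_vec_def)
qed

lemma op_diff: "op x (\<lambda>a b j. f a b j - g a b j) a b j = op x f a b j - op x g a b j"
proof -
  have "op x f = vadd (op x (\<lambda>a b j. f a b j - g a b j)) (op x g)"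
    by (simp flip: op_vadd) (simp add: vadd_def)
  then show ?thesis by (simp add: vadd_def)
qed

lemma whit_vec_cong:
  assumes I: "is_ideal I" and "\<And>a b j. f a b j - g a b j \<in> I" and "whit_vec I l g"
  shows "whit_vec I l f"
proof -
  have d: "op x f a b j - op x g a b j \<in> I" for x a b j
    using op_ideal[OF I, of "\<lambda>a b j. f a b j - g a b j" x] assms(2) by (simp add: op_diff)
  have "op E1 f a b j - sc (\<alpha> * X l) * f a b j =
     (op E1 f a b j - op E1 g a b j) + (op E1 g a b j - sc (\<alpha> * X l) * g a b j) - sc (\<alpha> * X l) * (f a b j - g a b j)"
     "op E2 f a b j = (op E2 f a b j - op E2 g a b j) + op E2 g a b j" for a b j
    by (simp_all add: algebra_simps)
  then show ?thesis
    using d assms unfolding whit_vec_def by (metis ideal_add ideal_diff ideal_mult)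
qed

lemma whit_vec_Uv:
  assumes I: "is_ideal I" and Qs: "\<And>n. 1 \<le> n \<Longrightarrow> hv (int n) * Qs n \<in> I"
  shows "whit_vec I l (Uv l Qs)"
proof -
  have "op E2 (Uv l Qs) a b j \<in> I" for a b j
  proof (cases "even (j - l)")
    case False
    then obtain s where "j - l = 2 * s + 1" by (elim oddE)
    then have j: "j = l + 2 * (s + 1) - 1" by simp
    show ?thesis
    proof (cases "a + b + 1 \<le> 0")
      case True
      then show ?thesis by (simp only: j Uv_E2 uscale_nonpositive) (simp add: ideal_zero[OF I])
    next
      case False
      then have "hv (a + b + 1) * Qs (nat (a + b + 1)) \<in> I"
        using Qs[of "nat (a + b + 1)"] by simp
      from ideal_mult[OF I ideal_mult[OF I this]] show ?thesis
        by (simp only: j Uv_E2)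
    qed
  qed (simp add: Uv_E2_even ideal_zero[OF I])
  then show ?thesis by (simp add: whit_vec_def Uv_E1 ideal_zero[OF I])
qed

text \<open>The \<open>E\<^sub>1\<close>-condition relates the coefficient at \<open>(a, b, j)\<close> to the one at \<open>(a - 1, b + 1, j - 2)\<close> with an
  invertible factor unless \<open>j = l\<close>; on the line \<open>j = l\<close> the \<open>E\<^sub>2\<close>-condition at \<open>j = l - 1\<close> relates
  \<open>(a, b + 1)\<close> to \<open>(a + 1, b)\<close>.\<close>

lemma whit_vec_unique:
  assumes I: "is_ideal I" and neg: "\<And>a b j. a < 0 \<or> b < 0 \<Longrightarrow> g a b j = 0"
    and g1: "\<And>a b j. op E1 g a b j - sc (\<alpha> * X l) * g a b j \<in> I"
    and g2: "\<And>a b. op E2 g a b (l - 1) \<in> I"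
    and g0: "\<And>a. 0 \<le> a \<Longrightarrow> g a 0 l \<in> I"
  shows "g a b j \<in> I"
proof -
  have chain: "g a b j \<in> I" if "j \<noteq> l" "g (a - 1) (b + 1) (j - 2) \<in> I" for a b j
  proof -
    have "sc (\<alpha> * (X j - X l)) * g a b j = (op E1 g a b j - sc (\<alpha> * X l) * g a b j)
       - sc (qn (b + 1)) * (Kp (- 1) * g (a - 1) (b + 1) (j - 2))"
      by (simp add: op.simps right_diff_distrib sc_diff left_diff_distrib)
    also have "\<dots> \<in> I"
      by (intro ideal_diff ideal_mult I g1 that)
    finally show ?thesis
      by (rule ideal_unscale[OF I]) (use that alpha0 in \<open>simp add: X_inject\<close>)
  qed
  \<comment> \<open>Induction on a, written int n - 1 to start at a = -1, where g vanishes. Along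
    the chain j drops by 2 and never meets l, because j is not l + 2s with s a natural
    number.\<close>
  have off: "g (int n - 1) b j \<in> I" if "\<And>s. j \<noteq> l + 2 * int s" for n b j
    using that
  proof (induction n arbitrary: b j)
    case 0
    then show ?case by (simp add: neg ideal_zero[OF I])
  next
    case (Suc n)
    have "j - 2 \<noteq> l + 2 * int s" for s using Suc.prems[of "Suc s"] by auto
    then have "g (int n - 1) (b + 1) (j - 2) \<in> I" by (rule Suc.IH)
    then show ?case using chain[of j "int n" b] Suc.prems[of 0] by simp
  qed
  have off': "g a b j \<in> I" if "\<And>s. j \<noteq> l + 2 * int s" for a b j
    using off[of j "nat (a + 1)" b] that neg[of a b j] ideal_zero[OF I] by (cases "0 \<le> a") auto
  have line: "g a (int b) l \<in> I" for a b
  proof (induction b arbitrary: a)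
    case 0
    then show ?case using g0 neg[of a 0 l] ideal_zero[OF I] by (cases "0 \<le> a") auto
  next
    case (Suc b)
    define c where "c = X (1 - int b - (l - 1)) * \<alpha>i * qn (int b + 1)"
    define e where "e = sc (qn (a + 1) * D) * (sc (X (- a - int b)) * g (a + 1) (int b) (l - 2) - sc (X (a + int b)) * g (a + 1) (int b) l)"
    \<comment> \<open>In the E_2 equation at j = l - 1, entries at l - 2 and l - 4 lie in I by
      \<open>off'\<close> and the one at (a + 1, b, l) by induction. What remains is the entry at
      (a, b + 1, l), with a nonzero scalar times the unit K.\<close>
    have neq: "l - 2 \<noteq> l + 2 * int s" "l - 4 \<noteq> l + 2 * int s" for s by auto
    have e: "e \<in> I" unfolding e_def by (intro ideal_mult ideal_diff I Suc.IH off' neq)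
    have "op E2 g a (int b) (l - 1) = sc c * (sc (D * D * X (- 1)) * (Kp 1 * g a (int b + 1) l)
        + sc (D * D * X 1) * (Kp (- 1) * g a (int b + 1) (l - 4)) - Cp * g a (int b + 1) (l - 2)) + e"
      by (simp add: op.simps c_def e_def)
    then have "sc (c * (D * D * X (- 1))) * (Kp 1 * g a (int b + 1) l) = op E2 g a (int b) (l - 1) - e
        - sc c * (sc (D * D * X 1) * (Kp (- 1) * g a (int b + 1) (l - 4)) - Cp * g a (int b + 1) (l - 2))"
      by (simp add: algebra_simps flip: sc_mult)
    also have "\<dots> \<in> I"
      by (intro ideal_mult ideal_diff I g2 e off' neq)
    finally have "Kp 1 * g a (int b + 1) l \<in> I"
      by (rule ideal_unscale[OF I]) (use alpha0 in \<open>simp add: c_def \<alpha>i_def qn_eq_0\<close>)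
    then show ?case by (simp add: add.commute ideal_unshift[OF I])
  qed
  have on: "g a b (l + 2 * int s) \<in> I" for a b s
  proof (induction s arbitrary: a b)
    case 0
    then show ?case
      using line[of a "nat b"] neg[of a b l] ideal_zero[OF I] by (cases "0 \<le> b") auto
  next
    case (Suc s)
    from Suc[of "a - 1" "b + 1"] have "g (a - 1) (b + 1) (l + 2 * int (Suc s) - 2) \<in> I"
      by (simp add: algebra_simps)
    then show ?case by (rule chain[rotated]) simp
  qed
  show ?thesis using on off'[of j a b] by (cases "\<exists>s. j = l + 2 * int s") auto
qed

lemma whit_vec_decompose:
  assumes I: "is_ideal I" and w: "whit_vec I l (phi x)"
  shows "\<exists>Qs n. (\<forall>a b j. phi x a b j - Uv l Qs a b j \<in> I) \<and> (\<forall>m. Qs m \<in> I \<longrightarrow> Qs m = 0)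
    \<and> (\<forall>m>n. Qs m = 0) \<and> (\<forall>m\<ge>1. hv (int m) * Qs m \<in> I)"
proof -
  obtain n where n: "\<And>a b j. phi x a b j \<noteq> 0 \<Longrightarrow> 0 \<le> a \<and> 0 \<le> b \<and> a + b \<le> int n"
    using phi_support[of x] by blast
  define f where "f = phi x"
  \<comment> \<open>Coefficients already in I are replaced by 0, so that every nonzero
    \<open>Qs m\<close> lies outside I, as the second family of generators demands.\<close>
  define Qs where "Qs = (\<lambda>m. if f (int m) 0 l \<in> I then 0 else f (int m) 0 l)"
  define g where "g = (\<lambda>a b j. f a b j - Uv l Qs a b j)"
  have g: "g a b j \<in> I" for a b j
  proof (rule whit_vec_unique[OF I])
    show "g a b j = 0" if "a < 0 \<or> b < 0" for a b j
    proof -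
      have "f a b j = 0" using n[of a b j] that by (cases "phi x a b j = 0") (auto simp: f_def)
      then show ?thesis using that by (simp add: g_def Uv_negative)
    qed
    show "op E1 g a b j - sc (\<alpha> * X l) * g a b j \<in> I" for a b j
    proof -
      have "op E1 g a b j - sc (\<alpha> * X l) * g a b j = op E1 f a b j - sc (\<alpha> * X l) * f a b j"
        unfolding g_def op_diff Uv_E1 by (simp add: algebra_simps)
      then show ?thesis using w by (simp add: whit_vec_def f_def)
    qed
    show "op E2 g a b (l - 1) \<in> I" for a b
    proof -
      \<comment> \<open>This is s = 0, where \<open>uscale\<close> vanishes: at j = l - 1 the E_2
        equation holds for \<open>Uv\<close> before anything is known about h_m
        \<open>Qs m\<close>.\<close>
      have "op E2 (Uv l Qs) a b (l - 1) = 0"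
        using Uv_E2[of l Qs a b 0] by (simp add: uscale_def)
      then show ?thesis using w by (simp add: whit_vec_def f_def g_def op_diff)
    qed
    show "g a 0 l \<in> I" if "0 \<le> a" for a
    proof -
      have "Uv l Qs a 0 l = Qs (nat a)"
        using that Uv_even[of l Qs a 0 0] by (simp add: cf_0_0)
      then show ?thesis using that by (simp add: g_def Qs_def ideal_zero[OF I])
    qed
  qed
  have hv: "hv (int m) * Qs m \<in> I" if "1 \<le> m" for m
  proof -
    have "op E2 (Uv l Qs) a b j \<in> I" for a b j
    proof -
      have "op E2 f a b j - op E2 g a b j \<in> I"
        using w op_ideal[OF I g] by (intro ideal_diff[OF I]) (auto simp: whit_vec_def f_def)
      then show ?thesis by (simp add: g_def op_diff)
    qed
    \<comment> \<open>The coordinate b = 0, s = 1 of degree n = m, where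
      \<open>uscale_nonzero\<close> applies.\<close>
    from this[of "int m - 1" 0 "l + 2 * 1 - 1"] 
    have "sc (uscale l (int m) 0 1) * (Kp (- 1) * (hv (int m) * Qs m)) \<in> I"
      unfolding Uv_E2 by simp
    then have "Kp (- 1) * (hv (int m) * Qs m) \<in> I"
      by (rule ideal_unscale[OF I]) (use uscale_nonzero[of "int m" l] that in simp)
    then show ?thesis by (rule ideal_unshift[OF I])
  qed
  have "Qs m = 0" if "n < m" for m
    using n[of "int m" 0 l] that by (auto simp: Qs_def f_def)
  moreover have "Qs m = 0" if "Qs m \<in> I" for m
    using that by (auto simp: Qs_def split: if_splits)
  ultimately show ?thesis
    using g hv unfolding g_def f_def by blast
qed

lemma phi_sum_uA:
  assumes "\<And>m. m \<notin> M \<Longrightarrow> Qs m = 0" "finite M"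
  shows "phi (\<Sum>m\<in>M. uA m l (Qs m)) = Uv l Qs"
proof (intro ext)
  fix a b j
  have "phi (\<Sum>m\<in>M. uA m l (Qs m)) a b j = (\<Sum>m\<in>M. Uv l (\<lambda>k. if k = m then Qs m else 0) a b j)"
    by (simp add: phi_sum phi_uA)
  also have "\<dots> = (\<Sum>m\<in>M. if m = nat (a + b) then Uv l Qs a b j else 0)"
    by (rule sum.cong) (auto simp: Uv_def)
  also have "\<dots> = Uv l Qs a b j"
    using assms by (auto simp: Uv_def)
  finally show "phi (\<Sum>m\<in>M. uA m l (Qs m)) a b j = Uv l Qs a b j" .
qed

lemma hv_cancel:
  assumes "hv n * Q = 0"
  shows "Q = 0"
proof (rule ccontr)
  assume "Q \<noteq> 0"
  define K where "K = Poly_Mapping.keys Q"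
  have K: "finite K" "K \<noteq> {}" using \<open>Q \<noteq> 0\<close> by (auto simp: K_def)
  \<comment> \<open>The C_1-degree of Q. In degree c + 1 the K and K^(-1) terms of h_n contribute
    nothing, and the C_1 term gives - (q - q^(-1))^2 times a top coefficient of Q.\<close>
  define c where "c = Max (snd ` K)"
  have "c \<in> snd ` K" unfolding c_def using K by (intro Max_in) auto
  then obtain m where m: "(m, c) \<in> K" by auto
  have top: "lk Q m' (int c + 1) = 0" for m'
  proof -
    have "(m', Suc c) \<notin> K"
    proof
      assume "(m', Suc c) \<in> K"
      then have "Suc c \<le> c" unfolding c_def using K by (intro Max_ge) force+
      then show False by simp
    qed
    then show ?thesis by (simp add: lk_def K_def in_keys_iff nat_add_distrib)
  qed
  have "lk (hv n * Q) m (int c + 1) = - ((q - inverse q)\<^sup>2 * lk Q m (int c))"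
    unfolding hv_def distrib_right left_diff_distrib mult.assoc lk_simps by (simp add: top)
  then have "(q - inverse q)\<^sup>2 * lk Q m (int c) = 0"
    by (simp add: assms lk_0)
  moreover have "q - inverse q \<noteq> 0"
    using D_nonzero by (auto simp: D_def)
  ultimately have "lk Q m (int c) = 0" by simp
  then show False using m by (simp add: lk_def K_def in_keys_iff)
qed

text \<open>M(\<eta>) is encoded with the empty set, which is not an ideal; this lets the results
  for ideals be applied with {0}.\<close>

lemma whit_sub_singleton_zero: "whit_sub q \<alpha> {0} = whit_sub q \<alpha> {}"
proof
  show "whit_sub q \<alpha> {0} \<subseteq> whit_sub q \<alpha> {}"
  proof
    fix w assume "w \<in> whit_sub q \<alpha> {0}"
    then show "w \<in> whit_sub q \<alpha> {}"
    proof induction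
      case (idl Q)
      then show ?case by (simp add: fa_of_ev whit_sub.zero flip: fa_of_zero)
    qed (auto intro: whit_sub.intros)
  qed
  show "whit_sub q \<alpha> {} \<subseteq> whit_sub q \<alpha> {0}"
  proof
    fix w assume "w \<in> whit_sub q \<alpha> {}"
    then show "w \<in> whit_sub q \<alpha> {0}" by induction (auto intro: whit_sub.intros)
  qed
qed

section \<open>The two descriptions of Whittaker vectors\<close>

definition whit_gens :: "lp set \<Rightarrow> int \<Rightarrow> fa set" where
  "whit_gens I l = {fa_mul (K2pow l) (lp_ev q Q) | Q. True}
     \<union> {u_vec q \<alpha> n l Q | n Q. n \<ge> 1 \<and> Q \<in> I_hat q I n \<and> Q \<notin> I}"

lemma fa_of_k2_ev: "fa_mul (K2pow l) (lp_ev q Q) = fa_of (uA 0 l Q)"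
  by (simp add: uA_0 fa_of_K2pow fa_of_ev to_fa)

lemma fa_span_sum:
  "(\<And>m. m \<in> M \<Longrightarrow> fa_of (f m) \<in> fa_span S) \<Longrightarrow> fa_of (\<Sum>m\<in>M. f m) \<in> fa_span S"
  by (induction M rule: infinite_finite_induct)
     (auto simp flip: fa_of_zero fa_of_add intro: fa_span.zero fa_span.add)

lemma whit_span:
  assumes I: "is_ideal I" and "z \<in> fa_span (whit_gens I l)"
  shows "\<exists>y. z = fa_of y \<and> whit_vec I l (phi y)"
  using assms(2)
proof induction
  case zero
  have "op x (phi 0) a b j = 0" for x a b j
    using phi_mult[of "gn x" 0] by (simp add: act_gn) (metis phi_zero)
  then have "whit_vec I l (phi 0)"
    by (simp add: whit_vec_def phi_zero ideal_zero[OF I])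
  then show ?case using fa_of_zero by blast
next
  case (base s)
  \<comment> \<open>Generators of the first family have n = 0, where the implication for
    \<open>I_hat\<close> is vacuous.\<close>
  then obtain n Q where s: "s = fa_of (uA n l Q)" and n: "1 \<le> n \<Longrightarrow> Q \<in> I_hat q I n"
    by (auto simp: whit_gens_def fa_of_k2_ev fa_of_u)
  have "whit_vec I l (phi (uA n l Q))"
    unfolding phi_uA by (rule whit_vec_Uv[OF I]) (use n in \<open>auto simp: I_hat_def h_poly_hv ideal_zero[OF I]\<close>)
  with s show ?case by blast
next
  case (add u v)
  then obtain x y where xy: "u = fa_of x" "v = fa_of y" "whit_vec I l (phi x)" "whit_vec I l (phi y)" by auto
  have p: "phi (x + y) = vadd (phi x) (phi y)" by (simp add: phi_def act_add)
  have "vadd F G a b j - sc k * vadd f g a b j = (F a b j - sc k * f a b j) + (G a b j - sc k * g a b j)"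
    for F G f g a b j k by (simp add: vadd_def algebra_simps)
  then have "whit_vec I l (phi (x + y))"
    using xy(3,4) unfolding p whit_vec_def op_vadd by (auto intro!: ideal_add[OF I]) (auto simp: vadd_def intro!: ideal_add[OF I])
  with xy show ?case by (auto simp: fa_of_add)
next
  case (smul u c)
  then obtain x where x: "u = fa_of x" "whit_vec I l (phi x)" by auto
  have p: "phi (sA c * x) = vsc c (phi x)" by (simp add: phi_mult act_sA)
  have "vsc c F a b j - sc k * vsc c f a b j = sc c * (F a b j - sc k * f a b j)"
    for F f a b j k by (simp add: vsc_def algebra_simps)
  then have "whit_vec I l (phi (sA c * x))"
    using x(2) unfolding p whit_vec_def op_vsc by (auto intro!: ideal_mult[OF I]) (auto simp: vsc_def intro!: ideal_mult[OF I])
  with x show ?case by (auto simp: fa_of_smul)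
qed

lemma whittaker_vectors:
  assumes I: "is_ideal I" and "w \<in> FA"
  shows "is_whittaker (whit_sub q \<alpha> I) (\<alpha> * q powi l) w \<longleftrightarrow>
    (\<exists>z\<in>fa_span (whit_gens I l). fa_diff w z \<in> whit_sub q \<alpha> I)"
proof -
  obtain x where x: "w = fa_of x" using assms(2) FA_fa_of by blast
  have diff: "fa_diff (fa_of x) (fa_of y) \<in> whit_sub q \<alpha> I \<longleftrightarrow> (\<forall>a b j. phi x a b j - phi y a b j \<in> I)" for y
    using Nset_iff_phi[OF I, of "x - y"] by (simp add: Nset_def fa_of_diff phi_diff)
  show ?thesis
    unfolding x is_whittaker_iff[OF I]
  proof
    assume "whit_vec I l (phi x)"
    then obtain Qs n where Qs: "\<And>a b j. phi x a b j - Uv l Qs a b j \<in> I" "\<And>m. Qs m \<in> I \<Longrightarrow> Qs m = 0"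
      "\<And>m. n < m \<Longrightarrow> Qs m = 0" "\<And>m. 1 \<le> m \<Longrightarrow> hv (int m) * Qs m \<in> I"
      using whit_vec_decompose[OF I] by blast
    define M where "M = {m. m \<le> n \<and> Qs m \<noteq> 0}"
    have M: "phi (\<Sum>m\<in>M. uA m l (Qs m)) = Uv l Qs"
      by (rule phi_sum_uA) (use Qs(3) in \<open>auto simp: M_def not_le\<close>)
    have "fa_of (uA m l (Qs m)) \<in> whit_gens I l" if "m \<in> M" for m
    proof (cases "m = 0")
      case True
      then show ?thesis by (auto simp: whit_gens_def simp flip: fa_of_k2_ev)
    next
      case False
      then have "1 \<le> m" "Qs m \<in> I_hat q I m" "Qs m \<notin> I"
        using Qs(2,4) that by (auto simp: I_hat_def h_poly_hv M_def)
      then show ?thesis by (auto simp: whit_gens_def simp flip: fa_of_u)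
    qed
    then have "fa_of (\<Sum>m\<in>M. uA m l (Qs m)) \<in> fa_span (whit_gens I l)"
      by (intro fa_span_sum fa_span.base)
    moreover have "fa_diff (fa_of x) (fa_of (\<Sum>m\<in>M. uA m l (Qs m))) \<in> whit_sub q \<alpha> I"
      unfolding diff M using Qs(1) by blast
    ultimately show "\<exists>z\<in>fa_span (whit_gens I l). fa_diff (fa_of x) z \<in> whit_sub q \<alpha> I" by blast
  next
    assume "\<exists>z\<in>fa_span (whit_gens I l). fa_diff (fa_of x) z \<in> whit_sub q \<alpha> I"
    then obtain y where "fa_diff (fa_of x) (fa_of y) \<in> whit_sub q \<alpha> I" "whit_vec I l (phi y)"
      using whit_span[OF I] by blast
    then show "whit_vec I l (phi x)"
      using whit_vec_cong[OF I] unfolding diff by blast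
  qed
qed

lemma whittaker_vectors_universal:
  assumes "w \<in> FA"
  shows "is_whittaker (whit_sub q \<alpha> {}) (\<alpha> * q powi l) w \<longleftrightarrow>
    (\<exists>Q. fa_diff w (fa_mul (K2pow l) (lp_ev q Q)) \<in> whit_sub q \<alpha> {})"
proof -
  note I = ideal_singleton_zero
  obtain x where x: "w = fa_of x" using assms FA_fa_of by blast
  have diff: "fa_diff (fa_of x) (fa_of y) \<in> whit_sub q \<alpha> {} \<longleftrightarrow> (\<forall>a b j. phi x a b j - phi y a b j \<in> {0})" for y
    using Nset_iff_phi[OF I, of "x - y"] by (simp add: Nset_def fa_of_diff phi_diff whit_sub_singleton_zero)
  have iff: "is_whittaker (whit_sub q \<alpha> {}) (\<alpha> * q powi l) (fa_of x) \<longleftrightarrow> whit_vec {0} l (phi x)"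
    using is_whittaker_iff[OF I] by (simp add: whit_sub_singleton_zero)
  show ?thesis
    unfolding x iff fa_of_k2_ev diff
  proof
    assume "whit_vec {0} l (phi x)"
    then obtain Qs n where Qs: "\<And>a b j. phi x a b j - Uv l Qs a b j \<in> {0}" "\<And>m. 1 \<le> m \<Longrightarrow> hv (int m) * Qs m \<in> {0}"
      using whit_vec_decompose[OF I] by blast
    have "Qs m = 0" if "1 \<le> m" for m
      using Qs(2)[OF that] hv_cancel by auto
    then have "Qs = (\<lambda>m. if m = 0 then Qs 0 else 0)" by (auto simp: fun_eq_iff)
    then have "Uv l Qs = phi (uA 0 l (Qs 0))" by (simp add: phi_uA)
    with Qs(1) show "\<exists>Q. \<forall>a b j. phi x a b j - phi (uA 0 l Q) a b j \<in> {0}" by metis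
  next
    assume "\<exists>Q. \<forall>a b j. phi x a b j - phi (uA 0 l Q) a b j \<in> {0}"
    then obtain Q where Q: "phi x a b j - phi (uA 0 l Q) a b j \<in> {0}" for a b j by blast
    have "whit_vec {0} l (phi (uA 0 l Q))"
      unfolding phi_uA by (rule whit_vec_Uv[OF I]) simp
    from whit_vec_cong[OF I Q this] show "whit_vec {0} l (phi x)" .
  qed
qed

end

theorem theorem4p4:
  fixes q \<alpha> :: complex and l :: int and I :: "lp set"
  assumes "q \<noteq> 0" and "\<forall>m::nat. m > 0 \<longrightarrow> q ^ m \<noteq> 1" and "\<alpha> \<noteq> 0"
    and "is_ideal I"
  shows "(\<forall>w\<in>FA. is_whittaker (whit_sub q \<alpha> I) (\<alpha> * q powi l) w \<longleftrightarrow>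
            (\<exists>z\<in>fa_span ({fa_mul (K2pow l) (lp_ev q Q) | Q. True}
                         \<union> {u_vec q \<alpha> n l Q | n Q. n \<ge> 1 \<and> Q \<in> I_hat q I n \<and> Q \<notin> I}).
               fa_diff w z \<in> whit_sub q \<alpha> I))
       \<and> (\<forall>w\<in>FA. is_whittaker (whit_sub q \<alpha> {}) (\<alpha> * q powi l) w \<longleftrightarrow>
            (\<exists>Q. fa_diff w (fa_mul (K2pow l) (lp_ev q Q)) \<in> whit_sub q \<alpha> {}))"
proof -
  interpret whittaker_sl3 q \<alpha>
    using assms by unfold_locales auto
  show ?thesis
    using whittaker_vectors[OF assms(4), of _ l, unfolded whit_gens_def] whittaker_vectors_universal
    by blast
qed

end
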